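(* Let $a,d\ge2$ and $k\ge1$ be integers. Set $$E_0=2a(d-1)+2,\qquad E_d=\begin{cases}5a(d-1)/2+2,&d\text{ odd},\\ a(5d-6)/2+3,&d\text{ even}.\end{cases}$$ (i) If $k\ge2$, then $W_{a,d}(q,k)-T(q)=k(1-k)^{d-1}q^{E_0}+O(q^{E_0+1})$. (ii) If $k=1$, then $W_{a,d}(q,1)-T(q)=(-1)^{d-1}q^{E_d}+O(q^{E_d+1})$. (iii) Let $k\ge3$ and $h=k-1$. If $0\le r\le E_d-E_0$, then $$h^{\,d-2-\lfloor r/a\rfloor-\lfloor(r-1)/a\rfloor}\ \bigm|\ [q^{E_0+r}]\bigl(W_{a,d}(q,k)-T(q)\bigr),$$ and the exponent of $h$ here is nonnegative throughout the range $0\le r\le E_d-E_0$. (iv) If $k\ge3$ and $h=k-1\ge3$, the first coefficient of $W_{a,d}(q,k)-T(q)$ that is nonzero modulo $h$ is the coefficient of $q^{E_d}$, and it is congruent modulo $h$ to $(-1)^{d-1}\{-k(k-3)/2\}^{\lfloor d/2\rfloor}$. (v) If $k=3$, the first coefficient of $W_{a,d}(q,3)-T(q)$ that is nonzero modulo $2$ is $1$ modulo $2$, and occurs at order $3a(d-1)+2$ if $d$ is odd and at order $a(3d-4)+4$ if $d$ is even.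
   Context: $\Phi(q)=\prod_{n\ge1}(1-q^n)$. For integers $a,d\ge2$, $k\ge1$, $$W_{a,d}(q,k)=\frac1d\sum_{z^d=1}\frac{\sum_{m\ge0}z^mq^{am+1}\Phi(q^{am+1})^k}{\sum_{m\ge0}z^mq^{a(m+1)}\Phi(q^{a(m+1)})^k},\qquad T(q)=q^{1-a}\frac{\Phi(q)^k}{\Phi(q^a)^k},$$ viewed here as formal Laurent series in $q$ (expansion at $q=0$); both lie in $q^{1-a}\mathbb Z[[q]]$. Equivalently, if $\dfrac{\sum_{m\ge0}X^m\Phi(q^{am+1})^k}{\sum_{m\ge0}X^m\Phi(q^{a(m+1)})^k}=\sum_{m\ge0}C_m(q)X^m$ in $\mathbb Z[[q]][[X]]$, then $W_{a,d}(q,k)=q^{1-a}\sum_{j\ge0}C_{jd}(q)q^{ajd}$. $[q^n]$ denotes the coefficient of $q^n$, and $O(q^n)$ means divisible by $q^n$ as a formal power series. Floors of negative numbers are the usual ones, e.g. $\lfloor -1/a\rfloor=-1$. *)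

theory Defs
  imports
    "HOL-Analysis.Analysis"
    "HOL-Computational_Algebra.Formal_Laurent_Series"
    "HOL-Number_Theory.Cong"
begin

text \<open>
  Infinite sums and products of formal power series are taken in the \<open>X\<close>-adic metric of the
  library (variable \<open>q = fps_X\<close>). The convergence lemmas below show that no \<open>prodinf\<close> or
  \<open>suminf\<close> used here takes a junk value.
\<close>

definition Phi :: "complex fps" where
  "Phi = (\<Prod>n. 1 - fps_X ^ Suc n)"

definition Phi_at :: "nat \<Rightarrow> complex fps" where
  "Phi_at n = fps_compose Phi (fps_X ^ n)"

definition W_num :: "nat \<Rightarrow> nat \<Rightarrow> complex \<Rightarrow> complex fps" where
  "W_num a k z = (\<Sum>m. fps_const (z ^ m) * fps_X ^ (a * m + 1) * Phi_at (a * m + 1) ^ k)"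

definition W_den :: "nat \<Rightarrow> nat \<Rightarrow> complex \<Rightarrow> complex fps" where
  "W_den a k z = (\<Sum>m. fps_const (z ^ m) * fps_X ^ (a * (m + 1)) * Phi_at (a * (m + 1)) ^ k)"

definition W_series :: "nat \<Rightarrow> nat \<Rightarrow> nat \<Rightarrow> complex fls" where
  "W_series a d k = fls_const (1 / of_nat d) *
     (\<Sum>z | z ^ d = 1. fps_to_fls (W_num a k z) / fps_to_fls (W_den a k z))"

definition T_series :: "nat \<Rightarrow> nat \<Rightarrow> complex fls" where
  "T_series a k = fls_X powi (1 - int a) * (fps_to_fls (Phi ^ k) / fps_to_fls (Phi_at a ^ k))"

lift_definition of_int_fls :: "int fls \<Rightarrow> 'a::ring_1 fls" is "\<lambda>f n. of_int (f n)"
  by (auto elim: eventually_mono)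

definition fls_bigO :: "int \<Rightarrow> 'a::comm_ring_1 fls \<Rightarrow> bool" where
  "fls_bigO n F \<longleftrightarrow> (\<exists>G :: 'a fps. F = fls_X_intpow n * fps_to_fls G)"

definition first_nonzero_mod :: "int \<Rightarrow> int fls \<Rightarrow> int \<Rightarrow> bool" where
  "first_nonzero_mod h F n \<longleftrightarrow> (\<forall>i<n. h dvd fls_nth F i) \<and> \<not> h dvd fls_nth F n"

definition E0 :: "nat \<Rightarrow> nat \<Rightarrow> int" where
  "E0 a d = 2 * int a * (int d - 1) + 2"

text \<open>Both divisions by 2 are exact.\<close>

definition Ed :: "nat \<Rightarrow> nat \<Rightarrow> int" where
  "Ed a d = (if odd d then 5 * int a * (int d - 1) div 2 + 2
             else int a * (5 * int d - 6) div 2 + 3)"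

definition h_exponent :: "nat \<Rightarrow> nat \<Rightarrow> int \<Rightarrow> int" where
  "h_exponent a d r =
     int d - 2 - \<lfloor>real_of_int r / real a\<rfloor> - \<lfloor>(real_of_int r - 1) / real a\<rfloor>"

context
  includes fps_syntax and no vec_syntax
begin

lemma convergent_prod_Phi:
  "convergent_prod (\<lambda>n. 1 - fps_X ^ Suc n :: complex fps)"
proof -
  define P where "P = (\<lambda>n. \<Prod>i\<le>n. 1 - fps_X ^ Suc i :: complex fps)"
  have step: "P (Suc n) $ j = P n $ j" if "j \<le> n" for n j
    using that by (simp add: P_def ring_distribs fps_X_power_mult_right_nth del: power_Suc)
  have stable: "P n $ j = P j $ j" if "j \<le> n" for n j
    using that by (induction n rule: dec_induct) (simp_all add: step)
  have "P \<longlonglongrightarrow> Abs_fps (\<lambda>j. P j $ j)"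
    unfolding tendsto_fps_iff
    by (auto intro!: tendsto_eventually simp: eventually_sequentially intro: stable)
  moreover have "Abs_fps (\<lambda>j. P j $ j) $ 0 \<noteq> 0 $ 0"
    by (simp add: P_def)
  then have "Abs_fps (\<lambda>j. P j $ j) \<noteq> 0"
    by metis
  ultimately show ?thesis
    unfolding convergent_prod_def raw_has_prod_def P_def
    by (intro exI[of _ 0] exI[of _ "Abs_fps (\<lambda>j. (\<Prod>i\<le>j. 1 - fps_X ^ Suc i) $ j)"]) simp
qed

lemma summable_fps_X_power:
  fixes c :: "nat \<Rightarrow> complex" and F :: "nat \<Rightarrow> complex fps"
  assumes "\<And>m. e m \<ge> m"
  shows "summable (\<lambda>m. fps_const (c m) * fps_X ^ e m * F m)"
proof -
  define S where "S = (\<lambda>n. \<Sum>m<n. fps_const (c m) * fps_X ^ e m * F m)"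
  have step: "S (Suc n) $ j = S n $ j" if "j < n" for n j
    using that assms[of n] by (simp add: S_def mult.assoc fps_X_power_mult_nth)
  have stable: "S n $ j = S (Suc j) $ j" if "Suc j \<le> n" for n j
    using that by (induction n rule: dec_induct) (simp_all add: step)
  have "S \<longlonglongrightarrow> Abs_fps (\<lambda>j. S (Suc j) $ j)"
    unfolding tendsto_fps_iff
    by (auto intro!: tendsto_eventually simp: eventually_sequentially intro: stable)
  then show ?thesis
    unfolding summable_def sums_def S_def by blast
qed

end

lemma summable_W_num:
  assumes "a \<ge> 1"
  shows "summable (\<lambda>m. fps_const (z ^ m) * fps_X ^ (a * m + 1) * Phi_at (a * m + 1) ^ k)"
  by (rule summable_fps_X_power) (use assms in \<open>simp add: le_SucI\<close>)

lemma summable_W_den: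
  assumes "a \<ge> 1"
  shows "summable (\<lambda>m. fps_const (z ^ m) * fps_X ^ (a * (m + 1)) * Phi_at (a * (m + 1)) ^ k)"
  by (rule summable_fps_X_power) (use assms in \<open>simp add: trans_le_add2\<close>)

end

theory Submission
  imports Defs
begin

text \<open>
  Put \<open>Q = q\<^sup>a\<close>, \<open>P = \<Phi>\<^sup>k\<close> and \<open>h = k - 1\<close>, and let \<open>C(X) = A(X) / B(X)\<close> be the generating quotient.
  Averaging over the roots of unity keeps the coefficients \<open>C\<^bsub>jd\<^esub>\<close>, and the term \<open>j = 0\<close> is \<open>T\<close>.
  After multiplying \<open>A\<close> and \<open>B\<close> by \<open>(1 - X)(1 - QX)\<close>, which removes the poles of the first two terms
  of the expansion of \<open>P\<close>, the substitution \<open>Y = QX\<close> is integral: \<open>q\<^bsup>a-1\<^esup> C(X) = G(QX)\<close>, where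
  \<open>G = N / D\<close> has coefficients \<open>g\<^sub>m\<close> in \<open>\<int>[[q]]\<close>. The coefficient of \<open>q\<close> to the power \<open>E\<^sub>0 + r\<close> in
  \<open>W - T\<close> is then \<open>[q\<^sup>r] g\<^sub>d\<close> in the relevant range.

  In \<open>D = 1 + hY + \<dots>\<close> every power of \<open>Y\<close> costs either a factor \<open>h\<close> or half a factor \<open>Q\<close>. Setting
  \<open>q = 0\<close> leaves \<open>1 + hY\<close> and gives (i); counting the factors \<open>h\<close> gives (iii). Modulo \<open>h\<close>, with
  \<open>P = 1 - kx + sx\<^bsup>t+1\<^esup> + \<dots>\<close>, the cheapest way to produce \<open>Y\<^sup>2\<close> is the term \<open>s Q\<^sup>t Y\<^sup>2\<close> of \<open>D\<close>,
  which dictates the leading term of \<open>g\<^sub>d\<close>. Part (iv) is \<open>t = 1\<close>, part (ii) is the same computation with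
  \<open>h = 0\<close>, and part (v) needs \<open>t = 2\<close> because \<open>\<Phi>\<^sup>3\<close> has no quadratic term.
\<close>

unbundle fps_syntax and no vec_syntax

subsection \<open>The quotient after rescaling\<close>

text \<open>The outer constant term has constant coefficient 1, so it is a unit of the base power
  series ring, and a series with unit constant term is invertible. Over the integers, quotients thus
  stay integral.\<close>

lemma fps_fps_right_invertible:
  fixes f :: "'a::comm_ring_1 fps fps"
  assumes "f $ 0 $ 0 = 1"
  shows "\<exists>g. f * g = 1"
proof -
  have "f $ 0 * fps_right_inverse (f $ 0) 1 = 1"
    using assms by (intro fps_right_inverse) simp
  then show ?thesis
    using fps_right_inverse by blast
qed

definition numer :: "nat \<Rightarrow> int fps \<Rightarrow> int fps fps" where
  "numer a P = Abs_fps (\<lambda>m. P oo fps_X ^ (a * m + 1))"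

definition denom :: "nat \<Rightarrow> int fps \<Rightarrow> int fps fps" where
  "denom a P = Abs_fps (\<lambda>m. P oo fps_X ^ (a * (m + 1)))"

definition dilate :: "'a::comm_ring_1 \<Rightarrow> 'a fps \<Rightarrow> 'a fps" where
  "dilate c F = Abs_fps (\<lambda>m. c ^ m * F $ m)"

lemma dilate_nth [simp]: "dilate c F $ m = c ^ m * F $ m"
  by (simp add: dilate_def)

lemma dilate_mult: "dilate c (F * G) = dilate c F * dilate c G"
proof (rule fps_ext)
  fix n
  have "c ^ n * (F $ i * G $ (n - i)) = c ^ i * F $ i * (c ^ (n - i) * G $ (n - i))"
    if "i \<le> n" for i
    using that power_add[of c i "n - i"] by (simp add: algebra_simps)
  then show "dilate c (F * G) $ n = (dilate c F * dilate c G) $ n"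
    by (simp add: fps_mult_nth sum_distrib_left)
qed

text \<open>The recurrence in the third claim kills the sequences 1 and Q^m, which are what the
  terms 1 and -kx of P contribute. Only the first two coefficients keep a trace of them.\<close>

lemma two_linear_factors_mult_nth:
  fixes Q :: "'a::comm_ring_1"
  defines "L \<equiv> (1 - fps_X) * (1 - fps_const Q * fps_X)"
  shows "(L * F) $ 0 = F $ 0"
    and "(L * F) $ Suc 0 = F $ Suc 0 - (1 + Q) * F $ 0"
    and "(L * F) $ Suc (Suc n) = F $ Suc (Suc n) - (1 + Q) * F $ Suc n + Q * F $ n"
proof -
  have L: "L * F = F - fps_const (1 + Q) * (fps_X * F) + fps_const Q * (fps_X ^ 2 * F)"
    by (simp add: L_def algebra_simps power2_eq_square flip: fps_const_add)
  have nth: "(fps_const c * G) $ i = c * G $ i" for c :: 'a and G i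
    by simp
  show "(L * F) $ 0 = F $ 0"
    and "(L * F) $ Suc 0 = F $ Suc 0 - (1 + Q) * F $ 0"
    and "(L * F) $ Suc (Suc n) = F $ Suc (Suc n) - (1 + Q) * F $ Suc n + Q * F $ n"
    unfolding L fps_add_nth fps_sub_nth nth
    by (simp_all add: fps_X_power_mult_nth)
qed

text \<open>Membership in the ideal generated by h and X^n. For h = 0 this is ordinary vanishing to
  order n, the case used for k = 1.\<close>

definition vanishes_mod :: "'a::comm_ring_1 \<Rightarrow> nat \<Rightarrow> 'a fps \<Rightarrow> bool" where
  "vanishes_mod h n f \<longleftrightarrow> (\<forall>i<n. h dvd f $ i)"

lemma vanishes_mod_0 [simp]: "vanishes_mod h 0 f"
  by (simp add: vanishes_mod_def)

lemma vanishes_mod_mono: "vanishes_mod h n f \<Longrightarrow> m \<le> n \<Longrightarrow> vanishes_mod h m f"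
  by (simp add: vanishes_mod_def)

lemma vanishes_mod_add: "vanishes_mod h n f \<Longrightarrow> vanishes_mod h n g \<Longrightarrow> vanishes_mod h n (f + g)"
  by (simp add: vanishes_mod_def)

lemma vanishes_mod_diff: "vanishes_mod h n f \<Longrightarrow> vanishes_mod h n g \<Longrightarrow> vanishes_mod h n (f - g)"
  by (simp add: vanishes_mod_def)

lemma vanishes_mod_sum: "(\<And>i. i \<in> I \<Longrightarrow> vanishes_mod h n (f i)) \<Longrightarrow> vanishes_mod h n (sum f I)"
  by (simp add: vanishes_mod_def fps_sum_nth dvd_sum)

lemma vanishes_mod_mult:
  assumes "vanishes_mod h n f" "vanishes_mod h m g"
  shows "vanishes_mod h (n + m) (f * g)"
  unfolding vanishes_mod_def fps_mult_nth
proof (intro allI impI dvd_sum)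
  fix i j assume "i < n + m" "j \<in> {0..i}"
  then have "j < n \<or> i - j < m" by auto
  then show "h dvd f $ j * g $ (i - j)"
    using assms by (auto simp: vanishes_mod_def)
qed

lemma vanishes_mod_mult_left: "vanishes_mod h n g \<Longrightarrow> vanishes_mod h n (f * g)"
  using vanishes_mod_mult[OF vanishes_mod_0] by simp

lemma vanishes_mod_X_power_mult: "vanishes_mod h m f \<Longrightarrow> vanishes_mod h (n + m) (fps_X ^ n * f)"
  by (simp add: vanishes_mod_def fps_X_power_mult_nth)

lemma vanishes_mod_const: "h dvd c \<Longrightarrow> vanishes_mod h n (fps_const c)"
  by (simp add: vanishes_mod_def)

lemma vanishes_mod_Suc_0: "f $ 0 = 0 \<Longrightarrow> vanishes_mod h (Suc 0) f"
  by (simp add: vanishes_mod_def)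

text \<open>With t as a parameter one computation serves twice: t = 1 for all powers of Phi, t = 2
  for Phi^3. The coefficient of x^(t+1) in P is \<open>S $ 0\<close>.\<close>

locale expansion =
  fixes a t :: nat and k :: int and P S :: "int fps"
  assumes a: "a \<ge> 2" and t: "t \<ge> 1"
    and P: "P = 1 - fps_const k * fps_X + fps_X ^ (t + 1) * S"
begin

abbreviation q :: "int fps" where "q \<equiv> fps_X"
abbreviation Q :: "int fps" where "Q \<equiv> fps_X ^ a"
abbreviation A :: "nat \<Rightarrow> int fps" where "A m \<equiv> P oo fps_X ^ (a * m + 1)"
abbreviation B :: "nat \<Rightarrow> int fps" where "B m \<equiv> P oo fps_X ^ (a * (m + 1))"
abbreviation \<alpha> :: "nat \<Rightarrow> int fps" where "\<alpha> m \<equiv> S oo fps_X ^ (a * m + 1)"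
abbreviation \<beta> :: "nat \<Rightarrow> int fps" where "\<beta> m \<equiv> S oo fps_X ^ (a * (m + 1))"

text \<open>
  \<open>Q\<^sup>m D\<^sub>m\<close> and \<open>Q\<^sup>m N\<^sub>m\<close> are the coefficients of \<open>X\<^sup>m\<close> in \<open>(1 - X)(1 - QX) B(X)\<close> and
  \<open>q\<^bsup>a-1\<^esup> (1 - X)(1 - QX) A(X)\<close>, with the powers of \<open>Q\<close> cancelled.
\<close>

fun D :: "nat \<Rightarrow> int fps" where
  "D 0 = B 0"
| "D (Suc 0) = fps_const (k - 1) + Q ^ (2 * t + 1) * \<beta> 1 - (1 + Q) * Q ^ t * \<beta> 0"
| "D (Suc (Suc m)) = Q ^ ((m + 3) * t + 1) * \<beta> (m + 2)
     - (1 + Q) * Q ^ ((m + 2) * t) * \<beta> (m + 1) + Q ^ ((m + 1) * t) * \<beta> m"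

fun N :: "nat \<Rightarrow> int fps" where
  "N 0 = q ^ (a - 1) * A 0"
| "N (Suc 0) = fps_const k - q ^ (a - 1) + q ^ t * Q ^ (t + 1) * \<alpha> 1 - (1 + Q) * q ^ t * \<alpha> 0"
| "N (Suc (Suc m)) = q ^ t * (Q ^ ((m + 2) * t + 1) * \<alpha> (m + 2)
     - (1 + Q) * Q ^ ((m + 1) * t) * \<alpha> (m + 1) + Q ^ (m * t) * \<alpha> m)"

lemma P_compose:
  assumes "n \<ge> 1"
  shows "P oo q ^ n = 1 - fps_const k * q ^ n + q ^ (n * (t + 1)) * (S oo q ^ n)"
proof -
  have n: "(q ^ n) $ 0 = 0" using assms by simp
  have "(q ^ (t + 1)) oo q ^ n = (q oo q ^ n) ^ (t + 1)"
    using fps_compose_power[OF n, of q "t + 1"] by simp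
  then show ?thesis
    unfolding P using n
    by (simp add: fps_compose_add_distrib fps_compose_sub_distrib fps_compose_mult_distrib
        del: power_Suc flip: power_mult)
qed

lemma A_eq: "A m = 1 - fps_const k * (q * Q ^ m) + q ^ (t + 1) * Q ^ (m * (t + 1)) * \<alpha> m"
proof -
  have "q ^ ((a * m + 1) * (t + 1)) = q ^ (t + 1) * Q ^ (m * (t + 1))"
    by (simp only: flip: power_mult power_add) (simp add: algebra_simps)
  then show ?thesis
    by (subst P_compose) (simp_all add: power_mult)
qed

lemma B_eq: "B m = 1 - fps_const k * Q ^ (m + 1) + Q ^ ((m + 1) * (t + 1)) * \<beta> m"
proof -
  have "1 \<le> a * (m + 1)" using a by simp
  from P_compose[OF this] show ?thesis
    by (simp only: mult.assoc flip: power_mult)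
qed

lemma q_Q: "q ^ (a - 1) * q = Q"
  using a by (simp flip: power_Suc2)

text \<open>From index 2 on only the tails in \<open>B_eq\<close> survive, and they carry enough
  powers of Q for the cancellation. At index 1 the lower terms leave 1 - k Q^2 - (1 + Q)(1 - k Q) =
  (k - 1) Q, the source of the factor h.\<close>

lemma dilate_D:
  "dilate Q (Abs_fps D) = (1 - fps_X) * (1 - fps_const Q * fps_X) * denom a P"
proof (rule fps_ext)
  fix n
  show "dilate Q (Abs_fps D) $ n = ((1 - fps_X) * (1 - fps_const Q * fps_X) * denom a P) $ n"
  proof (cases n rule: D.cases)
    case 1
    then show ?thesis by (simp only: two_linear_factors_mult_nth) (simp add: denom_def)
  next
    case 2
    have "B 1 = 1 - fps_const k * Q * Q + Q * Q * (Q ^ t * Q ^ t) * \<beta> 1"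
      and "B 0 = 1 - fps_const k * Q + Q * Q ^ t * \<beta> 0"
      by (subst B_eq, simp add: power_add mult_2 mult.assoc)+
    moreover have "r * (c - 1 + y * y * r * b - (1 + r) * y * b')
        = 1 - c * r * r + r * r * (y * y) * b - (1 + r) * (1 - c * r + r * y * b')"
      for r c y b b' :: "int fps"
      by (simp add: algebra_simps)
    ultimately have "Q * (fps_const k - 1 + Q ^ t * Q ^ t * Q * \<beta> 1 - (1 + Q) * Q ^ t * \<beta> 0)
        = B 1 - (1 + Q) * B 0"
      by (simp only:)
    moreover have "Q ^ (2 * t + 1) = Q ^ t * Q ^ t * Q"
      by (simp only: power_add mult_2 power_one_right)
    moreover have "fps_const (k - 1) = fps_const k - 1"
      by (simp flip: fps_const_sub)
    ultimately show ?thesis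
      unfolding 2 two_linear_factors_mult_nth dilate_nth fps_nth_Abs_fps D.simps denom_def
      by (simp only: Suc_eq_plus1 add_0 power_one_right)
  next
    case (3 m)
    \<comment> \<open>In these letters every power of Q for index m is a monomial, so the claim
      becomes a polynomial identity.\<close>
    define x y z where "x = Q ^ m" and "y = Q ^ t" and "z = Q ^ (m * t)"
    have "B m = 1 - fps_const k * (x * Q) + x * z * y * Q * \<beta> m"
      and "B (m + 1) = 1 - fps_const k * (x * Q * Q) + x * z * y * y * Q * Q * \<beta> (m + 1)"
      and "B (m + 2) = 1 - fps_const k * (x * Q * Q * Q)
             + x * z * y * y * y * Q * Q * Q * \<beta> (m + 2)"
      unfolding x_def y_def z_def
      by (subst B_eq, simp only: flip: power_mult power_add power_Suc2, simp add: algebra_simps)+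
    moreover have "x * r * r * (z * y * y * y * r * b'' - (1 + r) * (z * y * y) * b' + z * y * b)
        = 1 - c * (x * r * r * r) + x * z * y * y * y * r * r * r * b''
          - (1 + r) * (1 - c * (x * r * r) + x * z * y * y * r * r * b')
          + r * (1 - c * (x * r) + x * z * y * r * b)"
      for r c b b' b'' :: "int fps"
      by (simp add: algebra_simps)
    ultimately have "x * Q * Q * (z * y * y * y * Q * \<beta> (m + 2) - (1 + Q) * (z * y * y) * \<beta> (m + 1)
          + z * y * \<beta> m) = B (m + 2) - (1 + Q) * B (m + 1) + Q * B m"
      by (simp only:)
    moreover have "Q ^ ((m + 3) * t + 1) = z * y * y * y * Q" "Q ^ ((m + 2) * t) = z * y * y"
      "Q ^ ((m + 1) * t) = z * y" "Q ^ Suc (Suc m) = x * Q * Q"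
      unfolding x_def y_def z_def
      by (simp_all only: flip: power_mult power_add power_Suc2) (simp_all add: algebra_simps)
    ultimately show ?thesis
      unfolding 3 two_linear_factors_mult_nth dilate_nth fps_nth_Abs_fps D.simps denom_def
      by (simp only: Suc_eq_plus1 add.assoc one_add_one)
  qed
qed

text \<open>Beyond its constant term, \<open>A m\<close> carries an extra factor q, and q^(a-1) q =
  Q supplies the Q needed for the cancellation.\<close>

lemma dilate_N:
  "dilate Q (Abs_fps N) =
     (1 - fps_X) * (1 - fps_const Q * fps_X) * (fps_const (q ^ (a - 1)) * numer a P)"
proof (rule fps_ext)
  fix n
  let ?L = "(1 - fps_X) * (1 - fps_const Q * fps_X)"
  let ?F = "fps_const (q ^ (a - 1)) * numer a P"
  have F: "?F $ m = q ^ (a - 1) * A m" for m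
    by (simp add: numer_def)
  show "dilate Q (Abs_fps N) $ n = (?L * ?F) $ n"
  proof (cases n rule: N.cases)
    case 1
    then show ?thesis by (simp only: two_linear_factors_mult_nth F) simp
  next
    case 2
    define p where "p = q ^ (a - 1)"
    have "A 1 = 1 - fps_const k * q * Q + q * q ^ t * Q * Q ^ t * \<alpha> 1"
      and "A 0 = 1 - fps_const k * q + q * q ^ t * \<alpha> 0"
      by (subst A_eq, simp add: power_add mult_2 mult.assoc)+
    moreover have "p * q = Q"
      using q_Q by (simp add: p_def)
    moreover have "r * (c - p + z * (r * y) * b - (1 + r) * z * b')
        = p * (1 - c * x * r + x * z * r * y * b) - (1 + r) * (p * (1 - c * x + x * z * b'))"
      if "p * x = r" for r c y z x b b' :: "int fps"
      unfolding that[symmetric] by (simp add: algebra_simps)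
    ultimately have "Q * (fps_const k - p + q ^ t * (Q * Q ^ t) * \<alpha> 1 - (1 + Q) * q ^ t * \<alpha> 0)
        = p * A 1 - (1 + Q) * (p * A 0)"
      by (simp only:)
    then show ?thesis
      unfolding 2 two_linear_factors_mult_nth F by (simp add: p_def)
  next
    case (3 m)
    define p x y z where "p = q ^ (a - 1)" and "x = Q ^ m" and "y = Q ^ t" and "z = Q ^ (m * t)"
    have A: "A m = 1 - fps_const k * (q * x) + q ^ (t + 1) * (x * z) * \<alpha> m"
      and "A (m + 1) = 1 - fps_const k * (q * (x * Q)) + q ^ (t + 1) * (x * z * y * Q) * \<alpha> (m + 1)"
      and "A (m + 2) = 1 - fps_const k * (q * (x * Q * Q))
             + q ^ (t + 1) * (x * z * y * y * Q * Q) * \<alpha> (m + 2)"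
      unfolding x_def y_def z_def
      by (subst A_eq, simp only: flip: power_mult power_add power_Suc2, simp add: algebra_simps)+
    moreover have "p * q = Q" "q ^ (t + 1) = q * q ^ t"
      using q_Q by (simp_all add: p_def)
    moreover have "x * r * r * (w * (z * y * y * r * b'' - (1 + r) * (z * y) * b' + z * b))
        = p * (1 - c * (u * (x * r * r)) + u * w * (x * z * y * y * r * r) * b'')
          - (1 + r) * (p * (1 - c * (u * (x * r)) + u * w * (x * z * y * r) * b'))
          + r * (p * (1 - c * (u * x) + u * w * (x * z) * b))"
      if "p * u = r" for p r c u w b b' b'' :: "int fps"
      unfolding that[symmetric] by (simp add: algebra_simps)
    ultimately have "x * Q * Q * (q ^ t * (z * y * y * Q * \<alpha> (m + 2) - (1 + Q) * (z * y) * \<alpha> (m + 1)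
          + z * \<alpha> m)) = p * A (m + 2) - (1 + Q) * (p * A (m + 1)) + Q * (p * A m)"
      by (simp only:)
    moreover have "Q ^ ((m + 2) * t + 1) = z * y * y * Q" "Q ^ ((m + 1) * t) = z * y"
      "Q ^ Suc (Suc m) = x * Q * Q"
      unfolding x_def y_def z_def
      by (simp_all only: flip: power_mult power_add power_Suc2) (simp_all add: algebra_simps)
    ultimately show ?thesis
      unfolding 3 two_linear_factors_mult_nth F dilate_nth fps_nth_Abs_fps N.simps
      unfolding z_def[symmetric] p_def[symmetric]
      by (simp only: Suc_eq_plus1 add.assoc one_add_one)
  qed
qed

lemma P_nth_0: "P $ 0 = 1"
  by (subst P) simp

lemma D_nth_0: "D 0 $ 0 = 1" "D (Suc 0) $ 0 = k - 1" "D (Suc (Suc m)) $ 0 = 0"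
  using a t by (simp_all add: P_nth_0 fps_power_zeroth power_0_left)

lemma N_nth_0: "N 0 $ 0 = 0" "N (Suc 0) $ 0 = k" "N (Suc (Suc m)) $ 0 = 0"
  using a t by (simp_all add: fps_power_zeroth power_0_left)

lemma ex_G: "\<exists>G. Abs_fps D * G = Abs_fps N"
proof -
  have "Abs_fps D $ 0 $ 0 = 1"
    by (simp only: fps_nth_Abs_fps D_nth_0)
  then obtain E where "Abs_fps D * E = 1"
    using fps_fps_right_invertible by blast
  then have "Abs_fps D * (E * Abs_fps N) = Abs_fps N"
    by (simp flip: mult.assoc)
  then show ?thesis ..
qed

definition G :: "int fps fps" where
  "G = (SOME G. Abs_fps D * G = Abs_fps N)"

abbreviation g :: "nat \<Rightarrow> int fps" where "g m \<equiv> G $ m"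

lemma D_mult_G: "Abs_fps D * G = Abs_fps N"
  unfolding G_def using ex_G by (rule someI_ex)

text \<open>Multiplied by (1 - X)(1 - QX) B(X), both sides become the dilated numerator; this factor
  is nonzero in an integral domain, so it cancels.\<close>

lemma quotient_eq_dilate_G:
  assumes "denom a P * C = numer a P"
  shows "fps_const (q ^ (a - 1)) * C = dilate Q G"
proof -
  let ?L = "(1 - fps_X) * (1 - fps_const Q * fps_X) :: int fps fps"
  have "?L * denom a P * dilate Q G = ?L * denom a P * (fps_const (q ^ (a - 1)) * C)"
    by (simp only: dilate_D[symmetric] dilate_mult[symmetric] D_mult_G)
      (simp add: dilate_N dilate_D mult_ac flip: assms)
  moreover have "(?L * denom a P) $ 0 $ 0 = 1"
    by (simp add: denom_def P_nth_0)
  then have "?L * denom a P \<noteq> 0"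
    by force
  ultimately show ?thesis
    by (simp only: mult_cancel_left) simp
qed

section \<open>Recursion for the coefficients of G, and their values at q = 0\<close>

lemma ex_inverse_D0: "\<exists>u. u $ 0 = 1 \<and> u * D 0 = 1"
proof -
  have D0: "D 0 $ 0 = 1"
    by (rule D_nth_0)
  then have *: "D 0 * fps_right_inverse (D 0) 1 = 1"
    by (intro fps_right_inverse) simp
  then have "(D 0 * fps_right_inverse (D 0) 1) $ 0 = 1"
    by simp
  with D0 * show ?thesis
    by (intro exI[of _ "fps_right_inverse (D 0) 1"]) (simp add: mult.commute)
qed

definition u :: "int fps" where
  "u = (SOME u. u $ 0 = 1 \<and> u * D 0 = 1)"

lemma u: "u $ 0 = 1" "u * D 0 = 1"
  using someI_ex[OF ex_inverse_D0] by (simp_all only: u_def)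

text \<open>The coefficient of Y^m in D G = N, solved for its top term. Since u has constant term 1,
  the factor u changes neither orders nor leading coefficients.\<close>

lemma g_rec: "g m = u * (N m - (\<Sum>i=1..m. D i * g (m - i)))"
proof -
  have "N m = (Abs_fps D * G) $ m"
    by (simp only: D_mult_G fps_nth_Abs_fps)
  also have "\<dots> = D 0 * g m + (\<Sum>i=1..m. D i * g (m - i))"
    by (simp only: fps_mult_nth sum.atLeast_Suc_atMost[of 0] fps_nth_Abs_fps) simp
  finally show ?thesis
    using u(2) by (simp flip: mult.assoc)
qed

text \<open>At q = 0 the quotient is k Y / (1 + (k - 1) Y), a geometric series.\<close>

lemma g_nth_0: "g 0 $ 0 = 0" "g (Suc m) $ 0 = k * (1 - k) ^ m"
proof -
  show g0: "g 0 $ 0 = 0"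
    by (subst g_rec) (simp add: u N_nth_0 del: D.simps N.simps)
  show "g (Suc m) $ 0 = k * (1 - k) ^ m"
  proof (induction m)
    case 0
    show ?case
      by (subst g_rec) (simp add: u N_nth_0 D_nth_0 g0 del: D.simps N.simps)
  next
    case (Suc m)
    have "(\<Sum>i=1..Suc (Suc m). D i $ 0 * g (Suc (Suc m) - i) $ 0) =
        (\<Sum>i\<in>{1}. D i $ 0 * g (Suc (Suc m) - i) $ 0)"
    proof (intro sum.mono_neutral_right ballI)
      fix i assume "i \<in> {1..Suc (Suc m)} - {1}"
      then obtain j where "i = Suc (Suc j)"
        by (cases i rule: D.cases) auto
      then show "D i $ 0 * g (Suc (Suc m) - i) $ 0 = 0"
        by (simp add: D_nth_0 del: D.simps)
    qed auto
    then show ?case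
      by (subst g_rec)
        (simp add: u N_nth_0 D_nth_0 Suc fps_sum_nth algebra_simps del: D.simps N.simps sum.cl_ivl_Suc)
  qed
qed

text \<open>
  From \<open>m\<close> to \<open>m + 2\<close> the dominant contribution is \<open>- S(0) Q\<^sup>t Y\<^sup>2\<close>; the induction starts with \<open>k Y\<close> and
  \<open>S(0) q\<^sup>t Y\<^sup>2\<close> in the numerator. Only a lower bound is needed for \<open>m = 0\<close>, so \<open>lead 0\<close> is meaningless.
\<close>

definition v :: "nat \<Rightarrow> nat" where
  "v m = (if odd m then t * a * ((m - 1) div 2)
          else if m = 0 then a - 1 else t * a * ((m - 2) div 2) + t)"

lemma v_0: "v 0 = a - 1" and v_odd: "m = 2 * p + 1 \<Longrightarrow> v m = t * a * p"
  and v_even: "m = 2 * p + 2 \<Longrightarrow> v m = t * a * p + t"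
  by (simp_all add: v_def)

text \<open>The summand t a max(1, i - 1) is the order of \<open>D i\<close> modulo h. Hence in the
  recursion for m > 2 only i = 2 can reach order \<open>v m\<close>; for m = 2 even that product is
  too small, because \<open>g 0\<close> has order at least a - 1.\<close>

lemma v_less:
  assumes "1 \<le> i" "i \<le> m" "i \<noteq> 2 \<or> m = 2"
  shows "v m < t * a * max 1 (i - 1) + v (m - i)"
proof -
  define T where "T = t * a"
  have T: "2 * t \<le> T" "T > 0" "t < T"
    using a t by (simp_all add: T_def)
  note odd = v_odd[folded T_def] and even = v_even[folded T_def]
  have v12: "v 1 = 0" "v 2 = t"
    using odd[of 1 0] even[of 2 0] by simp_all
  obtain r where m: "m = i + r"
    using assms(2) le_Suc_ex by blast
  have r: "r = 0 \<or> (\<exists>p. r = 2 * p + 1) \<or> (\<exists>p. r = 2 * p + 2)"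
    by presburger
  have "i = 1 \<or> i = 2 \<or> (\<exists>j. i = 2 * j + 3) \<or> (\<exists>j. i = 2 * j + 4)"
    using assms(1) by presburger
  then have "v (i + r) < T * max 1 (i - 1) + v r"
  proof (elim disjE exE)
    assume i: "i = 1"
    show ?thesis
      using r
    proof (elim disjE exE)
      fix p assume "r = 2 * p + 1"
      with i have "v (i + r) = T * p + t" "v r = T * p"
        by (intro odd even; simp)+
      with i T show ?thesis by simp
    next
      fix p assume "r = 2 * p + 2"
      with i have "v (i + r) = T * (p + 1)" "v r = T * p + t"
        by (intro odd even; simp)+
      with i t show ?thesis by simp
    qed (use i T a v12 v_0 in simp)
  next
    assume "i = 2"
    then show ?thesis
      using m assms(3) T a v12 v_0 by simp
  next
    fix j assume i: "i = 2 * j + 3"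
    show ?thesis
      using r
    proof (elim disjE exE)
      assume "r = 0"
      with i have "v (i + r) = T * (j + 1)"
        by (intro odd even; simp)+
      with i T \<open>r = 0\<close> show ?thesis by (simp add: algebra_simps)
    next
      fix p assume "r = 2 * p + 1"
      with i have "v (i + r) = T * (j + p + 1) + t" "v r = T * p"
        by (intro odd even; simp)+
      with i T show ?thesis by (simp add: algebra_simps)
    next
      fix p assume "r = 2 * p + 2"
      with i have "v (i + r) = T * (j + p + 2)" "v r = T * p + t"
        by (intro odd even; simp)+
      with i t show ?thesis by (simp add: algebra_simps)
    qed
  next
    fix j assume i: "i = 2 * j + 4"
    show ?thesis
      using r
    proof (elim disjE exE)
      assume "r = 0"
      with i have "v (i + r) = T * (j + 1) + t"
        by (intro odd even; simp)+
      with i T \<open>r = 0\<close> show ?thesis by (simp add: algebra_simps)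
    next
      fix p assume "r = 2 * p + 1"
      with i have "v (i + r) = T * (j + p + 2)" "v r = T * p"
        by (intro odd even; simp)+
      with i T show ?thesis by (simp add: algebra_simps)
    next
      fix p assume "r = 2 * p + 2"
      with i have "v (i + r) = T * (j + p + 2) + t" "v r = T * p + t"
        by (intro odd even; simp)+
      with i T show ?thesis by (simp add: algebra_simps)
    qed
  qed
  then show ?thesis by (simp add: T_def m)
qed

lemma v_add_2:
  assumes "m \<ge> 1"
  shows "v (m + 2) = t * a + v m"
proof -
  have "(\<exists>p. m = 2 * p + 1) \<or> (\<exists>p. m = 2 * p + 2)"
    using assms by presburger
  then show ?thesis
  proof (elim disjE exE)
    fix p assume "m = 2 * p + 1"
    then show ?thesis
      using v_odd[of m p] v_odd[of "m + 2" "p + 1"] by simp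
  next
    fix p assume "m = 2 * p + 2"
    then show ?thesis
      using v_even[of m p] v_even[of "m + 2" "p + 1"] by simp
  qed
qed

subsection \<open>The leading term modulo a divisor of \<open>k - 1\<close>\<close>

lemma vanishes_mod_q_mult: "n \<le> e \<Longrightarrow> vanishes_mod h n (q ^ e * f)"
  using vanishes_mod_X_power_mult[of h 0 f e] by (auto intro: vanishes_mod_mono)

lemma vanishes_mod_Q_mult: "n \<le> a * e \<Longrightarrow> vanishes_mod h n (Q ^ e * f)"
  unfolding power_mult[symmetric] by (rule vanishes_mod_q_mult)

text \<open>Once the multiple k - 1 of h is discarded, the least exponent of Q is t for i = 1 and (i
  - 1) t for i >= 2.\<close>

lemma D_vanishes:
  assumes "h dvd k - 1" "i \<ge> 1"
  shows "vanishes_mod h (t * a * max 1 (i - 1)) (D i)"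
proof (cases i rule: D.cases)
  case 2
  show ?thesis
    unfolding 2 D.simps mult.assoc mult.left_commute[of "1 + Q"]
    using assms(1)
    by (intro vanishes_mod_add vanishes_mod_diff vanishes_mod_Q_mult vanishes_mod_const)
      simp_all
next
  case (3 m)
  show ?thesis
    unfolding 3 D.simps mult.assoc mult.left_commute[of "1 + Q"]
    by (intro vanishes_mod_add vanishes_mod_diff vanishes_mod_Q_mult) (simp_all add: algebra_simps)
qed (use assms in simp)

text \<open>The leading term comes from the summand Q^t \<open>\<beta> 0\<close>; the other two are
  divisible by Q^(2t).\<close>

lemma D_2: "vanishes_mod h (t * a + 1) (D 2 - fps_const (S $ 0) * q ^ (t * a))"
proof -
  have pos: "0 < t * a" using a t by simp
  have "D 2 - fps_const (S $ 0) * q ^ (t * a) = Q ^ (3 * t + 1) * \<beta> 2 - Q ^ (2 * t) * ((1 + Q) * \<beta> 1)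
      + q ^ (t * a) * (\<beta> 0 - fps_const (S $ 0))"
    by (simp add: numeral_2_eq_2 algebra_simps flip: power_mult)
  moreover have "vanishes_mod h (t * a + 1) (q ^ (t * a) * (\<beta> 0 - fps_const (S $ 0)))"
    using a by (intro vanishes_mod_X_power_mult) (simp add: vanishes_mod_Suc_0)
  ultimately show ?thesis
    using pos
    by (simp only:)
      (intro vanishes_mod_add vanishes_mod_diff vanishes_mod_Q_mult; simp add: algebra_simps)
qed

lemma N_1: "vanishes_mod h (Suc 0) (N 1 - fps_const k)"
  by (intro vanishes_mod_Suc_0) (simp add: N_nth_0 del: N.simps)

lemma N_2: "vanishes_mod h (t + 1) (N 2 - fps_const (S $ 0) * q ^ t)"
proof -
  have "N 2 - fps_const (S $ 0) * q ^ t
      = q ^ t * (Q ^ (2 * t + 1) * \<alpha> 2 - Q ^ t * ((1 + Q) * \<alpha> 1) + (\<alpha> 0 - fps_const (S $ 0)))"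
    by (simp add: numeral_2_eq_2 algebra_simps)
  moreover have "vanishes_mod h (Suc 0)
      (Q ^ (2 * t + 1) * \<alpha> 2 - Q ^ t * ((1 + Q) * \<alpha> 1) + (\<alpha> 0 - fps_const (S $ 0)))"
    using a t by (intro vanishes_mod_Suc_0) (simp add: fps_power_zeroth power_0_left)
  ultimately show ?thesis
    using vanishes_mod_X_power_mult[of h "Suc 0" _ t] by simp
qed

lemma N_vanishes: "vanishes_mod h (t * (1 + a * m)) (N (m + 2))"
proof -
  have "vanishes_mod h (t + a * (m * t)) (N (m + 2))"
    unfolding add_2_eq_Suc' N.simps mult.assoc mult.left_commute[of "1 + Q"]
    by (intro vanishes_mod_X_power_mult vanishes_mod_add vanishes_mod_diff vanishes_mod_Q_mult)
      (simp_all add: algebra_simps)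
  then show ?thesis by (simp add: algebra_simps del: N.simps)
qed

definition lead :: "nat \<Rightarrow> int" where
  "lead m = (if odd m then k * (- S $ 0) ^ (m div 2) else S $ 0 * (- S $ 0) ^ (m div 2 - 1))"

lemma lead_simps: "lead 1 = k" "lead 2 = S $ 0"
  by (simp_all add: lead_def)

lemma lead_add_2: "m \<ge> 1 \<Longrightarrow> lead (m + 2) = - S $ 0 * lead m"
  by (cases "m div 2") (auto simp: lead_def)

lemma vanishes_mod_unit_mult:
  assumes "vanishes_mod h (n + 1) (f - fps_const c * q ^ n)" and "w $ 0 = 1"
  shows "vanishes_mod h (n + 1) (w * f - fps_const c * q ^ n)"
proof -
  have "w * f - fps_const c * q ^ n
      = w * (f - fps_const c * q ^ n) + fps_const c * (q ^ n * (w - 1))"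
    by (simp add: algebra_simps)
  moreover have "vanishes_mod h (n + 1) (q ^ n * (w - 1))"
    using assms by (intro vanishes_mod_X_power_mult) (simp add: vanishes_mod_Suc_0)
  ultimately show ?thesis
    using assms(1) by (auto intro: vanishes_mod_add vanishes_mod_mult_left)
qed

lemma g_0: "vanishes_mod h (a - 1) (g 0)"
  by (subst g_rec) (simp add: vanishes_mod_mult_left vanishes_mod_q_mult)

text \<open>Strong induction through \<open>g_rec\<close>. For m = 1, 2 the leading term is that of
  \<open>N m\<close>; for m >= 3 the order of \<open>N m\<close> exceeds \<open>v m\<close>, and the
  term is inherited from \<open>D 2 * g (m - 2)\<close>.\<close>

lemma g_lead:
  assumes h: "h dvd k - 1" and "m \<ge> 1"
  shows "vanishes_mod h (v m + 1) (g m - fps_const (lead m) * q ^ v m)"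
  using assms(2)
proof (induction m rule: less_induct)
  case (less m)
  have g: "vanishes_mod h (v j) (g j)" if "j < m" for j
  proof (cases "j = 0")
    case True
    then show ?thesis using g_0 by (simp add: v_0)
  next
    case False
    with less that have "vanishes_mod h (v j + 1) (g j - fps_const (lead j) * q ^ v j)"
      by simp
    then have "vanishes_mod h (v j) (g j - fps_const (lead j) * q ^ v j)"
      by (rule vanishes_mod_mono) simp
    then have "vanishes_mod h (v j)
        ((g j - fps_const (lead j) * q ^ v j) + fps_const (lead j) * (q ^ v j * 1))"
      by (intro vanishes_mod_add vanishes_mod_mult_left vanishes_mod_q_mult) simp_all
    then show ?thesis by simp
  qed
  have small: "vanishes_mod h (v m + 1) (D i * g (m - i))"
    if "i \<in> {1..m}" "i \<noteq> 2 \<or> m = 2" for i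
    using that less.prems h v_less[of i m]
    by (intro vanishes_mod_mono[OF vanishes_mod_mult[OF D_vanishes g]]) auto
  have "vanishes_mod h (v m + 1)
      (N m - (\<Sum>i=1..m. D i * g (m - i)) - fps_const (lead m) * q ^ v m)"
  proof (cases "m \<ge> 3")
    case False
    then have m: "m = 1 \<or> m = 2" using less.prems by auto
    then have "vanishes_mod h (v m + 1) (N m - fps_const (lead m) * q ^ v m)"
      using N_1 N_2 v_odd[of 1 0] v_even[of 2 0]
      by (auto simp: lead_simps lead_simps[simplified] simp del: N.simps)
    moreover have "vanishes_mod h (v m + 1) (\<Sum>i=1..m. D i * g (m - i))"
      using m by (intro vanishes_mod_sum small) auto
    ultimately have "vanishes_mod h (v m + 1)
        ((N m - fps_const (lead m) * q ^ v m) - (\<Sum>i=1..m. D i * g (m - i)))"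
      by (rule vanishes_mod_diff)
    then show ?thesis by (simp only: Groups.diff_right_commute)
  next
    case True
    define l where "l = m - 2"
    have l: "m = l + 2" "l \<ge> 1" using True by (auto simp: l_def)
    have "v m < t * (1 + a * l)"
    proof -
      have "(\<exists>p. l = 2 * p + 1) \<or> (\<exists>p. l = 2 * p + 2)"
        using l(2) by presburger
      then show ?thesis
        using a t v_odd[of l] v_even[of l] v_add_2[OF l(2)] l
        by (auto simp: algebra_simps)
    qed
    then have Nm: "vanishes_mod h (v m + 1) (N m)"
      using l by (intro vanishes_mod_mono[OF N_vanishes[of h l, folded l(1)]]) simp
    have rest: "vanishes_mod h (v m + 1) (\<Sum>i\<in>{1..m} - {2}. D i * g (m - i))"
      by (intro vanishes_mod_sum small) auto
    \<comment> \<open>The product \<open>D 2 * g l\<close> minus the product of leading terms is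
      split in two: first the error of \<open>D 2\<close>, then the error of \<open>g l\<close> from
      the induction hypothesis.\<close>
    have "vanishes_mod h (t * a + 1 + v l) ((D 2 - fps_const (S $ 0) * q ^ (t * a)) * g l)"
      using l by (intro vanishes_mod_mult D_2 g) simp
    moreover have "vanishes_mod h (t * a + (v l + 1))
        (q ^ (t * a) * (g l - fps_const (lead l) * q ^ v l))"
      using l less by (intro vanishes_mod_X_power_mult) simp
    ultimately have "vanishes_mod h (v m + 1) ((D 2 - fps_const (S $ 0) * q ^ (t * a)) * g l
         + fps_const (S $ 0) * (q ^ (t * a) * (g l - fps_const (lead l) * q ^ v l)))"
      using v_add_2[OF l(2)] l
      by (intro vanishes_mod_add vanishes_mod_mult_left[where f = "fps_const (S $ 0)"])
        (simp_all add: add_ac del: D.simps)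
    with Nm rest have "vanishes_mod h (v m + 1) (N m
        - ((\<Sum>i\<in>{1..m} - {2}. D i * g (m - i)) + ((D 2 - fps_const (S $ 0) * q ^ (t * a)) * g l
         + fps_const (S $ 0) * (q ^ (t * a) * (g l - fps_const (lead l) * q ^ v l)))))"
      by (rule vanishes_mod_diff[OF _ vanishes_mod_add])
    moreover have "(\<Sum>i=1..m. D i * g (m - i)) = D 2 * g l + (\<Sum>i\<in>{1..m} - {2}. D i * g (m - i))"
      using True by (subst sum.remove[of _ 2]) (auto simp: l_def)
    moreover have "fps_const (lead m) * q ^ v m
        = - (fps_const (S $ 0) * fps_const (lead l) * (q ^ (t * a) * q ^ v l))"
      using l v_add_2[OF l(2)] lead_add_2[OF l(2)]
      by (simp add: power_add fps_const_neg[symmetric] del: fps_const_neg)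
    moreover have "n - (d * x + r) - (- (s * c * (y * z)))
        = n - (r + ((d - s * y) * x + s * (y * (x - c * z))))" for n d x r s c y z :: "int fps"
      by (simp add: algebra_simps)
    ultimately show ?thesis
      by (simp only:)
  qed
  then show ?case
    using u(1) by (subst g_rec) (rule vanishes_mod_unit_mult)
qed

lemma g_coeff:
  assumes "h dvd k - 1" and "m \<ge> 1"
  shows "i < v m \<Longrightarrow> h dvd g m $ i" and "h dvd g m $ v m - lead m"
proof -
  have *: "h dvd g m $ i - lead m * (if i = v m then 1 else 0)" if "i \<le> v m" for i
    using g_lead[OF assms] that by (simp add: vanishes_mod_def)
  show "h dvd g m $ i" if "i < v m"
    using *[of i] that by simp
  show "h dvd g m $ v m - lead m"
    using *[of "v m"] by simp
qed

subsection \<open>Divisibility by powers of \<open>k - 1\<close>\<close>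

text \<open>
  The second summand is the ceiling of \<open>s / a\<close>, that is \<open>\<lfloor>(s - 1) / a\<rfloor> + 1\<close> also for \<open>s = 0\<close>.
\<close>

definition floor_sum :: "nat \<Rightarrow> nat" where
  "floor_sum s = s div a + (s + a - 1) div a"

lemma floor_sum_add: "floor_sum s + 2 * (r div a) \<le> floor_sum (s + r)"
proof -
  have "s div a + r div a \<le> (s + r) div a"
    and "(s + a - 1) div a + r div a \<le> (s + a - 1 + r) div a"
    by (subst div_add1_eq, linarith)+
  moreover have "s + a - 1 + r = s + r + a - 1"
    using a by simp
  ultimately show ?thesis
    unfolding floor_sum_def by simp
qed

text \<open>The extra 1 comes from the ceiling, which rounds up as soon as s exceeds a l.\<close>

lemma floor_sum_ge: "a * l + b \<le> (s :: nat) \<Longrightarrow> 2 * l + (if b > 0 then 1 else 0) \<le> floor_sum s"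
proof -
  assume s: "a * l + b \<le> s"
  have "a * l \<le> s" "a * (l + (if b > 0 then 1 else 0)) \<le> s + a - 1"
    using s a by (auto simp: algebra_simps)
  then have "l \<le> s div a" "l + (if b > 0 then 1 else 0) \<le> (s + a - 1) div a"
    using a by (simp_all add: less_eq_div_iff_mult_less_eq mult.commute)
  then show ?thesis by (simp add: floor_sum_def)
qed

text \<open>
  \<open>F m\<close> contains the coefficient of \<open>Y\<^sup>m\<close> in \<open>D\<close>, \<open>M m\<close> those in \<open>N\<close> and \<open>G\<close>; \<open>M\<close> is a filtered module
  over \<open>F\<close>, which transports the divisibility through the division \<open>N / D\<close>.
\<close>

definition F :: "nat \<Rightarrow> int fps set" where
  "F m = {f. \<forall>s. (k - 1) ^ (m - 2 * (s div a)) dvd f $ s}"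

definition M :: "nat \<Rightarrow> int fps set" where
  "M m = {f. \<forall>s. (k - 1) ^ (m - 1 - floor_sum s) dvd f $ s}"

lemma F_mult_M:
  assumes "f \<in> F i" "f' \<in> M j"
  shows "f * f' \<in> M (i + j)"
  unfolding M_def mem_Collect_eq fps_mult_nth
proof (intro allI dvd_sum)
  fix s r :: nat assume "r \<in> {0..s}"
  then have "floor_sum (s - r) + 2 * (r div a) \<le> floor_sum s"
    using floor_sum_add[of "s - r" r] by simp
  \<comment> \<open>Truncated subtraction can only enlarge the summands on the right, so the
    inequality survives negative differences.\<close>
  then have "i + j - 1 - floor_sum s \<le> (i - 2 * (r div a)) + (j - 1 - floor_sum (s - r))"
    by linarith
  then have "(k - 1) ^ (i + j - 1 - floor_sum s) dvd
      (k - 1) ^ ((i - 2 * (r div a)) + (j - 1 - floor_sum (s - r)))"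
    by (rule le_imp_power_dvd)
  also have "\<dots> dvd f $ r * f' $ (s - r)"
    using assms unfolding power_add F_def M_def by (intro mult_dvd_mono) simp_all
  finally show "(k - 1) ^ (i + j - 1 - floor_sum s) dvd f $ r * f' $ (s - r)" .
qed

lemma M_diff: "f \<in> M m \<Longrightarrow> f' \<in> M m \<Longrightarrow> f - f' \<in> M m"
  and M_add: "f \<in> M m \<Longrightarrow> f' \<in> M m \<Longrightarrow> f + f' \<in> M m"
  by (simp_all add: M_def)

lemma M_sum: "(\<And>i. i \<in> I \<Longrightarrow> h i \<in> M m) \<Longrightarrow> sum h I \<in> M m"
  by (simp add: M_def fps_sum_nth dvd_sum)

lemma F_diff: "f \<in> F m \<Longrightarrow> f' \<in> F m \<Longrightarrow> f - f' \<in> F m"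
  and F_add: "f \<in> F m \<Longrightarrow> f' \<in> F m \<Longrightarrow> f + f' \<in> F m"
  by (simp_all add: F_def)

text \<open>Each factor Q pays for two powers of k - 1: below order a e the coefficients vanish,
  from there on the required exponent is 0.\<close>

lemma F_Q_mult: "m \<le> 2 * e \<Longrightarrow> Q ^ e * f \<in> F m"
  unfolding F_def mem_Collect_eq power_mult[symmetric] fps_X_power_mult_nth
proof
  fix s assume m: "m \<le> 2 * e"
  have "m - 2 * (s div a) = 0" if "a * e \<le> s"
  proof -
    have "e \<le> s div a"
      using a that by (simp add: less_eq_div_iff_mult_less_eq mult.commute)
    with m show ?thesis by simp
  qed
  then show "(k - 1) ^ (m - 2 * (s div a)) dvd (if s < a * e then 0 else f $ (s - a * e))"
    by (cases "s < a * e") simp_all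
qed

text \<open>Besides 2 e from the powers of Q, the positive power of q gains one more unit through
  the ceiling, covering m - 1 <= 2 e + 1.\<close>

lemma M_qQ_mult:
  assumes "m \<le> 2 * e + 2" "n > 0"
  shows "q ^ n * (Q ^ e * f) \<in> M m"
proof -
  have "m - 1 - floor_sum s = 0" if "a * e + n \<le> s" for s
    using assms floor_sum_ge[OF that] by simp
  then have "(k - 1) ^ (m - 1 - floor_sum s) dvd (if s < a * e + n then 0 else f $ (s - (a * e + n)))" for s
    by (cases "s < a * e + n") simp_all
  moreover have "q ^ n * (Q ^ e * f) = q ^ (a * e + n) * f"
    by (simp only: power_add power_mult mult_ac)
  ultimately show ?thesis
    by (simp only: M_def fps_X_power_mult_nth mem_Collect_eq) blast
qed

lemma M_le_1: "m \<le> 1 \<Longrightarrow> f \<in> M m"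
  by (simp add: M_def)

lemma F_0: "f \<in> F 0"
  by (simp add: F_def)

text \<open>At i = 1 the constant k - 1 supplies the required factor itself; every other term for i
  >= 1 has enough powers of Q because t >= 1.\<close>

lemma D_in_F: "D i \<in> F i"
proof (cases i rule: D.cases)
  case 2
  have "fps_const (k - 1) \<in> F 1"
    by (simp add: F_def power_0_left)
  then show ?thesis
    unfolding 2 D.simps mult.assoc mult.left_commute[of "1 + Q"]
    using t by (intro F_add F_diff F_Q_mult) simp_all
next
  case (3 m)
  have "Suc (Suc m) \<le> 2 * ((m + 3) * t + 1)" "Suc (Suc m) \<le> 2 * ((m + 2) * t)"
    "Suc (Suc m) \<le> 2 * ((m + 1) * t)"
    using t by (cases t; simp add: algebra_simps)+
  then show ?thesis
    unfolding 3 D.simps mult.assoc mult.left_commute[of "1 + Q"]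
    by (intro F_add F_diff F_Q_mult)
qed (simp add: F_0)

lemma N_in_M: "N i \<in> M i"
proof (cases i rule: N.cases)
  case (3 m)
  have "Suc (Suc m) \<le> 2 * ((m + 2) * t + 1) + 2" "Suc (Suc m) \<le> 2 * ((m + 1) * t) + 2"
    "Suc (Suc m) \<le> 2 * (m * t) + 2" "0 < t"
    using t by (cases t; simp add: algebra_simps)+
  then show ?thesis
    unfolding 3 N.simps mult.assoc mult.left_commute[of "1 + Q"] distrib_left[of "q ^ t"]
      right_diff_distrib[of "q ^ t"]
    by (intro M_add M_diff M_qQ_mult)
qed (simp_all add: M_le_1 del: N.simps)

lemma g_in_M: "g m \<in> M m"
proof (induction m rule: less_induct)
  case (less m)
  have "D i * g (m - i) \<in> M m" if "i \<in> {1..m}" for i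
    using that F_mult_M[OF D_in_F less[of "m - i"], of i] by simp
  then have "N m - (\<Sum>i=1..m. D i * g (m - i)) \<in> M m"
    by (intro M_diff N_in_M M_sum)
  then show ?case
    using F_mult_M[OF F_0, of _ m u] by (subst g_rec) simp
qed

end

subsection \<open>Evaluation and averaging over roots of unity\<close>

definition of_int_fps :: "int fps \<Rightarrow> 'a::ring_1 fps" where
  "of_int_fps f = Abs_fps (\<lambda>n. of_int (f $ n))"

lemma of_int_fps_nth [simp]: "of_int_fps f $ n = of_int (f $ n)"
  by (simp add: of_int_fps_def)

lemma of_int_fps_1: "of_int_fps 1 = 1"
  by (rule fps_ext) simp

lemma of_int_fps_mult: "of_int_fps (f * g) = of_int_fps f * of_int_fps g"
  by (rule fps_ext) (simp add: fps_mult_nth)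

lemma of_int_fps_power: "of_int_fps (f ^ n) = of_int_fps f ^ n"
  by (induction n) (simp_all add: of_int_fps_1 of_int_fps_mult)

lemma of_int_fps_compose_X_power:
  "n > 0 \<Longrightarrow> (of_int_fps (f oo fps_X ^ n) :: 'a::comm_ring_1 fps) = of_int_fps f oo fps_X ^ n"
  by (rule fps_ext) (simp add: fps_nth_compose_X_power)

lemma of_int_fls_nth: "fls_nth (of_int_fls f) i = of_int (fls_nth f i)"
  by (simp add: of_int_fls.rep_eq)

lemma of_int_fls_shift_fps:
  "of_int_fls (fls_X_intpow i * fps_to_fls f) = fls_X_intpow i * fps_to_fls (of_int_fps f)"
  by (rule fls_eqI) (simp add: of_int_fls_nth fls_X_intpow_times_conv_shift)

text \<open>Substitution of y. If y has no constant term, y^m has order at least m, so the cut at m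
  <= n loses nothing and no limit is involved.\<close>

definition eval_at :: "'a::comm_ring_1 fps \<Rightarrow> 'a fps fps \<Rightarrow> 'a fps" where
  "eval_at y F = Abs_fps (\<lambda>n. (\<Sum>m\<le>n. y ^ m * F $ m) $ n)"

lemma power_mult_nth_eq_0:
  fixes y :: "'a::comm_ring_1 fps"
  assumes "y $ 0 = 0" "n < m"
  shows "(y ^ m * f) $ n = 0"
  unfolding fps_mult_nth using startsby_zero_power_prefix[OF assms(1), of m] assms(2)
  by (intro sum.neutral) auto

lemma eval_at_nth:
  assumes "y $ 0 = 0" "n \<le> M"
  shows "eval_at y F $ n = (\<Sum>m\<le>M. y ^ m * F $ m) $ n"
  unfolding eval_at_def fps_nth_Abs_fps fps_sum_nth
proof (intro sum.mono_neutral_left ballI)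
  fix m assume "m \<in> {..M} - {..n}"
  then show "(y ^ m * F $ m) $ n = 0"
    using assms(1) by (intro power_mult_nth_eq_0) auto
qed (use assms in auto)

text \<open>Both factors may be cut at the same n, and products with m + l > n do not reach
  coefficient n, so the double sum can be regrouped along m + l = p.\<close>

lemma eval_at_mult:
  assumes y: "y $ 0 = 0"
  shows "eval_at y (F * G) = eval_at y F * eval_at y G"
proof (rule fps_ext)
  fix n
  let ?t = "\<lambda>m l. y ^ (m + l) * (F $ m * G $ l)"
  have "(eval_at y F * eval_at y G) $ n
      = ((\<Sum>m\<le>n. y ^ m * F $ m) * (\<Sum>m\<le>n. y ^ m * G $ m)) $ n"
    unfolding fps_mult_nth
    by (intro sum.cong refl) (auto simp: eval_at_nth[OF y, of _ n])
  also have "\<dots> = (\<Sum>(m, l)\<in>{..n} \<times> {..n}. ?t m l $ n)"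
    by (simp add: sum_product fps_sum_nth sum.cartesian_product power_add mult_ac case_prod_unfold)
  also have "\<dots> = (\<Sum>(m, l)\<in>{(m, l). m + l \<le> n}. ?t m l $ n)"
    by (rule sum.mono_neutral_right) (auto intro: power_mult_nth_eq_0[OF y])
  also have "\<dots> = (\<Sum>p\<le>n. \<Sum>m\<le>p. ?t m (p - m) $ n)"
    by (rule sum.triangle_reindex_eq)
  also have "\<dots> = (\<Sum>p\<le>n. y ^ p * (F * G) $ p) $ n"
    by (simp add: fps_sum_nth fps_mult_nth sum_distrib_left atMost_atLeast0)
  also have "\<dots> = eval_at y (F * G) $ n"
    by (simp add: eval_at_def)
  finally show "eval_at y (F * G) $ n = (eval_at y F * eval_at y G) $ n" ..
qed

definition of_int_fps2 :: "int fps fps \<Rightarrow> complex fps fps" where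
  "of_int_fps2 F = Abs_fps (\<lambda>m. of_int_fps (F $ m))"

lemma of_int_fps2_mult: "of_int_fps2 (F * G) = of_int_fps2 F * of_int_fps2 G"
proof -
  have "of_int_fps (sum f A) = (\<Sum>i\<in>A. of_int_fps (f i) :: complex fps)"
    for f :: "nat \<Rightarrow> int fps" and A
    by (rule fps_ext) (simp add: fps_sum_nth)
  then show ?thesis
    by (intro fps_ext[of "of_int_fps2 (F * G)"])
      (simp add: of_int_fps2_def fps_mult_nth[of F] fps_mult_nth[of "Abs_fps _"] of_int_fps_mult)
qed

section \<open>Integrality of Phi, and the two sums as evaluations at z q^a\<close>

definition Phi_int :: "int fps" where
  "Phi_int = Abs_fps (\<lambda>n. (\<Prod>i\<le>n. 1 - fps_X ^ Suc i) $ n)"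

text \<open>Factors of index beyond j are 1 modulo X^(j+2). This justifies reading coefficient j of
  \<open>Phi_int\<close> off a partial product.\<close>

lemma prod_nth_stable:
  "j \<le> n \<Longrightarrow> (\<Prod>i\<le>n. 1 - fps_X ^ Suc i :: 'a::comm_ring_1 fps) $ j = (\<Prod>i\<le>j. 1 - fps_X ^ Suc i) $ j"
  by (induction n rule: dec_induct)
    (simp_all add: ring_distribs fps_X_power_mult_right_nth del: power_Suc)

lemma Phi_eq: "Phi = of_int_fps Phi_int"
proof -
  let ?f = "\<lambda>n. 1 - fps_X ^ Suc n :: complex fps"
  have of_int_prod: "(\<Prod>i\<le>j. ?f i) = of_int_fps (\<Prod>i\<le>j. 1 - fps_X ^ Suc i)" for j
  proof (induction j)
    case (Suc j)
    have "1 - fps_X ^ n = (of_int_fps (1 - fps_X ^ n) :: complex fps)" for n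
      by (rule fps_ext) simp
    with Suc show ?case by (simp add: of_int_fps_mult del: power_Suc)
  qed (rule fps_ext, simp)
  have lim: "(\<lambda>n. \<Prod>i\<le>n. ?f i) \<longlonglongrightarrow> of_int_fps Phi_int"
    unfolding tendsto_fps_iff
  proof (intro allI tendsto_eventually)
    fix j
    have "(\<Prod>i\<le>n. ?f i) $ j = of_int_fps Phi_int $ j" if "n \<ge> j" for n
      using prod_nth_stable[OF that, where 'a = int] by (simp add: of_int_prod Phi_int_def del: power_Suc)
    then show "\<forall>\<^sub>F n in sequentially. (\<Prod>i\<le>n. ?f i) $ j = of_int_fps Phi_int $ j"
      by (auto simp: eventually_sequentially)
  qed
  have "of_int_fps Phi_int $ 0 \<noteq> (0 :: complex)"
    by (simp add: Phi_int_def)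
  then have "of_int_fps Phi_int \<noteq> (0 :: complex fps)"
    by force
  with lim have "?f has_prod of_int_fps Phi_int"
    by (simp add: has_prod_def raw_has_prod_def)
  \<comment> \<open>Nonzero factors exclude the alternative in \<open>has_prod\<close> where the
    product is 0, so the value is the limit of the partial products.\<close>
  moreover have "?f i \<noteq> 0" for i
  proof -
    have "?f i $ 0 \<noteq> 0" by simp
    then show ?thesis by force
  qed
  then have "p = of_int_fps Phi_int" if "?f has_prod p" for p
    using that lim LIMSEQ_unique unfolding has_prod_def raw_has_prod_def by fastforce
  ultimately show ?thesis
    unfolding Phi_def prodinf_def by (rule the_equality)
qed

lemma Phi_at_power_eq:
  "n > 0 \<Longrightarrow> Phi_at n ^ k = of_int_fps (Phi_int ^ k oo fps_X ^ n)"
  by (simp add: Phi_at_def Phi_eq of_int_fps_compose_X_power of_int_fps_power fps_compose_power)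

lemma suminf_fps_nth:
  fixes c :: "nat \<Rightarrow> complex" and F :: "nat \<Rightarrow> complex fps"
  assumes "\<And>m. e m \<ge> m"
  shows "(\<Sum>m. fps_const (c m) * fps_X ^ e m * F m) $ n
    = (\<Sum>m\<le>n. fps_const (c m) * fps_X ^ e m * F m) $ n"
proof -
  let ?f = "\<lambda>m. fps_const (c m) * fps_X ^ e m * F m"
  have zero: "?f m $ n = 0" if "n < m" for m
    using that assms[of m] by (simp add: mult.assoc fps_X_power_mult_nth)
  have "(\<lambda>N. \<Sum>m<N. ?f m) \<longlonglongrightarrow> (\<Sum>m. ?f m)"
    by (intro summable_LIMSEQ summable_fps_X_power assms)
  then have "(\<lambda>N. (\<Sum>m<N. ?f m) $ n) \<longlonglongrightarrow> (\<Sum>m. ?f m) $ n"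
    by (auto simp: tendsto_fps_iff intro: tendsto_eventually)
  moreover have "(\<lambda>N. (\<Sum>m<N. ?f m) $ n) \<longlonglongrightarrow> (\<Sum>m\<le>n. ?f m) $ n"
  proof (rule tendsto_eventually, unfold eventually_sequentially, intro exI allI impI)
    fix N assume "Suc n \<le> N"
    then show "(\<Sum>m<N. ?f m) $ n = (\<Sum>m\<le>n. ?f m) $ n"
      unfolding fps_sum_nth by (intro sum.mono_neutral_right) (use zero in auto)
  qed
  ultimately show ?thesis
    by (rule LIMSEQ_unique)
qed

text \<open>Since z^m q^(am+1) = q (z q^a)^m, the sum is q A(X) at X = z q^a.\<close>

lemma W_num_eq:
  assumes "a \<ge> 1"
  shows "W_num a k z
    = fps_X * eval_at (fps_const z * fps_X ^ a) (of_int_fps2 (numer a (Phi_int ^ k)))"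
proof (rule fps_ext)
  fix n
  let ?y = "fps_const z * fps_X ^ a :: complex fps"
  have "W_num a k z $ n
      = (\<Sum>m\<le>n. fps_const (z ^ m) * fps_X ^ (a * m + 1) * Phi_at (a * m + 1) ^ k) $ n"
    unfolding W_num_def
    by (rule suminf_fps_nth) (use assms in \<open>simp add: le_SucI\<close>)
  also have "(\<Sum>m\<le>n. fps_const (z ^ m) * fps_X ^ (a * m + 1) * Phi_at (a * m + 1) ^ k)
      = fps_X * (\<Sum>m\<le>n. ?y ^ m * of_int_fps2 (numer a (Phi_int ^ k)) $ m)"
    unfolding sum_distrib_left
  proof (intro sum.cong refl)
    fix m
    have "Phi_at (a * m + 1) ^ k = of_int_fps2 (numer a (Phi_int ^ k)) $ m"
      by (subst Phi_at_power_eq) (simp_all add: of_int_fps2_def numer_def)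
    moreover have "fps_X ^ (a * m + 1) = (fps_X * (fps_X ^ a) ^ m :: complex fps)"
      by (simp add: power_mult)
    ultimately show "fps_const (z ^ m) * fps_X ^ (a * m + 1) * Phi_at (a * m + 1) ^ k
        = fps_X * (?y ^ m * of_int_fps2 (numer a (Phi_int ^ k)) $ m)"
      by (simp only: power_mult_distrib fps_const_power mult_ac)
  qed
  also have "(fps_X * (\<Sum>m\<le>n. ?y ^ m * of_int_fps2 (numer a (Phi_int ^ k)) $ m)) $ n
      = (fps_X * eval_at ?y (of_int_fps2 (numer a (Phi_int ^ k)))) $ n"
  proof -
    have "?y $ 0 = 0" using assms by simp
    from eval_at_nth[OF this, of "n - 1" n] show ?thesis by simp
  qed
  finally show "W_num a k z $ n = \<dots>" .
qed

lemma W_den_eq: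
  assumes "a \<ge> 1"
  shows "W_den a k z
    = fps_X ^ a * eval_at (fps_const z * fps_X ^ a) (of_int_fps2 (denom a (Phi_int ^ k)))"
proof (rule fps_ext)
  fix n
  let ?y = "fps_const z * fps_X ^ a :: complex fps"
  have "W_den a k z $ n
      = (\<Sum>m\<le>n. fps_const (z ^ m) * fps_X ^ (a * (m + 1)) * Phi_at (a * (m + 1)) ^ k) $ n"
    unfolding W_den_def
    by (rule suminf_fps_nth) (use assms in \<open>simp add: trans_le_add2\<close>)
  also have "(\<Sum>m\<le>n. fps_const (z ^ m) * fps_X ^ (a * (m + 1)) * Phi_at (a * (m + 1)) ^ k)
      = fps_X ^ a * (\<Sum>m\<le>n. ?y ^ m * of_int_fps2 (denom a (Phi_int ^ k)) $ m)"
    unfolding sum_distrib_left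
  proof (intro sum.cong refl)
    fix m
    have "Phi_at (a * (m + 1)) ^ k = of_int_fps2 (denom a (Phi_int ^ k)) $ m"
      by (subst Phi_at_power_eq) (use assms in \<open>simp_all add: of_int_fps2_def denom_def\<close>)
    moreover have "fps_X ^ (a * (m + 1)) = (fps_X ^ a * (fps_X ^ a) ^ m :: complex fps)"
      by (simp only: power_mult Suc_eq_plus1[symmetric] power_Suc)
    ultimately show "fps_const (z ^ m) * fps_X ^ (a * (m + 1)) * Phi_at (a * (m + 1)) ^ k
        = fps_X ^ a * (?y ^ m * of_int_fps2 (denom a (Phi_int ^ k)) $ m)"
      by (simp only: power_mult_distrib fps_const_power mult_ac)
  qed
  also have "(fps_X ^ a * (\<Sum>m\<le>n. ?y ^ m * of_int_fps2 (denom a (Phi_int ^ k)) $ m)) $ n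
      = (fps_X ^ a * eval_at ?y (of_int_fps2 (denom a (Phi_int ^ k)))) $ n"
  proof -
    have "?y $ 0 = 0" using assms by simp
    from eval_at_nth[OF this, of "n - a" n] show ?thesis by (simp add: fps_X_power_mult_nth)
  qed
  finally show "W_den a k z $ n = \<dots>" .
qed

text \<open>If d does not divide m, multiplication by w = exp(2 pi i / d) permutes the roots and
  scales the sum by w^m, which is not 1.\<close>

lemma sum_roots_of_unity_power:
  assumes "d > 0"
  shows "(\<Sum>z::complex | z ^ d = 1. z ^ m) = (if d dvd m then of_nat d else 0)"
proof (cases "d dvd m")
  case True
  then show ?thesis
    using assms card_roots_unity_eq[OF assms] by (auto simp: power_mult)
next
  case False
  define w where "w = cis (2 * pi / d)"
  have w: "w ^ d = 1"
  proof -
    have "w ^ d = cis (real d * (2 * pi / d))"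
      unfolding w_def by (rule Complex.DeMoivre)
    also have "real d * (2 * pi / d) = 2 * pi"
      using assms by simp
    finally show ?thesis by simp
  qed
  have "w ^ m \<noteq> 1"
  proof
    assume "w ^ m = 1"
    then have "cis (2 * pi * m / d) = 1"
      by (simp add: w_def Complex.DeMoivre mult_ac)
    then have "cos (2 * pi * m / d) = 1"
      by (simp add: complex_eq_iff)
    then obtain i :: int where "2 * pi * m / d = i * 2 * pi"
      using cos_one_2pi_int by auto
    then have "real m = real_of_int i * d"
      using assms by (simp add: field_simps)
    then have "int m = i * int d"
      by (metis of_int_eq_iff of_int_mult of_int_of_nat_eq)
    then have "int d dvd int m"
      by simp
    with False show False
      by simp
  qed
  moreover have "(\<Sum>z::complex | z ^ d = 1. z ^ m) = (\<Sum>z::complex | z ^ d = 1. (w * z) ^ m)"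
    by (rule sum.reindex_bij_witness[of _ "\<lambda>z. w * z" "\<lambda>z. z / w"])
      (use w in \<open>auto simp: power_mult_distrib power_divide w_def\<close>)
  then have "(\<Sum>z::complex | z ^ d = 1. z ^ m) = w ^ m * (\<Sum>z::complex | z ^ d = 1. z ^ m)"
    by (simp only: power_mult_distrib flip: sum_distrib_left)
  ultimately show ?thesis
    using False by simp
qed

text \<open>The series sum_j C_(jd) q^(ajd); for a >= 1 only m <= n reach the coefficient of
  q^n.\<close>

definition average :: "nat \<Rightarrow> nat \<Rightarrow> int fps fps \<Rightarrow> int fps" where
  "average a d C = Abs_fps (\<lambda>n. \<Sum>m | m \<le> n \<and> d dvd m. ((fps_X ^ a) ^ m * C $ m) $ n)"

lemma average_roots_of_unity:
  assumes "d > 0" "a > 0"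
  shows "(\<Sum>z::complex | z ^ d = 1. eval_at (fps_const z * fps_X ^ a) (of_int_fps2 C))
    = of_nat d * of_int_fps (average a d C)"
proof (rule fps_ext)
  fix n
  let ?c = "\<lambda>m. of_int (((fps_X ^ a) ^ m * C $ m) $ n) :: complex"
  have "eval_at (fps_const z * fps_X ^ a) (of_int_fps2 C) $ n = (\<Sum>m\<le>n. z ^ m * ?c m)" for z
    by (simp add: eval_at_def of_int_fps2_def fps_sum_nth power_mult_distrib mult.assoc
        fps_X_power_mult_nth if_distrib flip: power_mult cong: if_cong)
  then have "(\<Sum>z::complex | z ^ d = 1. eval_at (fps_const z * fps_X ^ a) (of_int_fps2 C)) $ n
      = (\<Sum>m\<le>n. \<Sum>z | z ^ d = 1. z ^ m * ?c m)"
    by (simp add: fps_sum_nth sum.swap[of _ "{..n}"])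
  also have "\<dots> = (\<Sum>m\<le>n. if d dvd m then of_nat d * ?c m else 0)"
    using assms
    by (intro sum.cong) (simp_all add: sum_roots_of_unity_power flip: sum_distrib_right)
  also have "\<dots> = (\<Sum>m | m \<le> n \<and> d dvd m. of_nat d * ?c m)"
    by (simp add: sum.If_cases Int_def)
  also have "\<dots> = (of_nat d * of_int_fps (average a d C)) $ n"
    by (simp add: average_def sum_distrib_left flip: fps_of_nat)
  finally show "(\<Sum>z::complex | z ^ d = 1. eval_at (fps_const z * fps_X ^ a) (of_int_fps2 C)) $ n
      = (of_nat d * of_int_fps (average a d C)) $ n" .
qed

text \<open>Evaluating B C = A at z q^a shows each quotient to be q^(1-a) C(z q^a). The sum over z
  produces a factor d that cancels 1/d, leaving integer coefficients.\<close>

lemma W_series_eq: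
  assumes "a \<ge> 1" "d \<ge> 1" and C: "denom a (Phi_int ^ k) * C = numer a (Phi_int ^ k)"
  shows "W_series a d k = of_int_fls (fls_X_intpow (1 - int a) * fps_to_fls (average a d C))"
proof -
  let ?C = "\<lambda>z. eval_at (fps_const z * fps_X ^ a) (of_int_fps2 C)"
  have quot: "fps_to_fls (W_num a k z) / fps_to_fls (W_den a k z)
      = fls_X_intpow (1 - int a) * fps_to_fls (?C z)" for z
  proof -
    let ?y = "fps_const z * fps_X ^ a :: complex fps"
    let ?den = "eval_at ?y (of_int_fps2 (denom a (Phi_int ^ k)))"
    have "Phi_int $ 0 = 1"
      by (simp add: Phi_int_def)
    then have "?den $ 0 = 1"
      by (simp add: eval_at_def of_int_fps2_def denom_def fps_power_zeroth)
    then have "?den \<noteq> 0"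
      by force
    then have nz: "fps_to_fls (W_den a k z) \<noteq> 0"
      using assms by (simp add: W_den_eq)
    have "eval_at ?y (of_int_fps2 (numer a (Phi_int ^ k))) = ?den * ?C z"
      using assms(1) by (simp add: eval_at_mult of_int_fps2_mult flip: C)
    then have "fps_to_fls (W_num a k z) = fls_X * (fps_to_fls ?den * fps_to_fls (?C z))"
      using assms by (simp add: W_num_eq fls_times_fps_to_fls)
    also have "\<dots> = fls_X_intpow (1 - int a) * fps_to_fls (?C z) * fps_to_fls (W_den a k z)"
    proof -
      have "fls_X_intpow (1 - int a) * fps_to_fls (fps_X ^ a) = (fls_X :: complex fls)"
        unfolding fls_X_intpow_times_conv_shift by (rule fls_eqI) auto
      then show ?thesis
        using assms by (simp add: W_den_eq fls_times_fps_to_fls mult_ac)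
    qed
    finally show ?thesis
      using nz by (simp add: field_simps)
  qed
  have "W_series a d k = fls_const (1 / of_nat d) *
      (fls_X_intpow (1 - int a) * fps_to_fls (\<Sum>z | z ^ d = 1. ?C z))"
  proof -
    have "fps_to_fls (sum f A) = (\<Sum>i\<in>A. fps_to_fls (f i))" for f :: "complex \<Rightarrow> complex fps" and A
      by (induction A rule: infinite_finite_induct) simp_all
    then show ?thesis
      by (simp add: W_series_def quot sum_distrib_left)
  qed
  also have "(\<Sum>z | z ^ d = 1. ?C z) = of_nat d * of_int_fps (average a d C)"
    using assms by (intro average_roots_of_unity) simp_all
  also have "fls_const (1 / of_nat d) * (fls_X_intpow (1 - int a) * fps_to_fls \<dots>)
      = fls_X_intpow (1 - int a) * fps_to_fls (of_int_fps (average a d C))"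
    using assms unfolding fls_X_intpow_times_conv_shift
    by (intro fls_eqI) (simp add: fls_mult_const_nth flip: fps_of_nat)
  finally show ?thesis
    by (simp only: of_int_fls_shift_fps)
qed

text \<open>The coefficient of X^0 in B C = A reads Phi(q^a)^k C_0 = Phi(q)^k.\<close>

lemma T_series_eq:
  assumes "a \<ge> 1" and C: "denom a (Phi_int ^ k) * C = numer a (Phi_int ^ k)"
  shows "T_series a k = of_int_fls (fls_X_intpow (1 - int a) * fps_to_fls (C $ 0))"
proof -
  have "(denom a (Phi_int ^ k) * C) $ 0 = Phi_int ^ k"
    by (simp add: C numer_def)
  then have "Phi ^ k = of_int_fps ((Phi_int ^ k oo fps_X ^ a) * C $ 0)"
    by (simp add: denom_def Phi_eq flip: of_int_fps_power)
  also have "\<dots> = Phi_at a ^ k * of_int_fps (C $ 0)"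
    using assms by (simp add: Phi_at_power_eq of_int_fps_mult)
  finally have eq: "fps_to_fls (Phi ^ k) = fps_to_fls (of_int_fps (C $ 0)) * fps_to_fls (Phi_at a ^ k)"
    by (simp add: fls_times_fps_to_fls)
  have "Phi_int $ 0 = 1"
    by (simp add: Phi_int_def)
  then have "(Phi_at a ^ k) $ 0 = 1"
    using assms by (simp add: Phi_at_power_eq fps_power_zeroth)
  then have "Phi_at a ^ k \<noteq> 0"
    by force
  then have "fps_to_fls (Phi ^ k) / fps_to_fls (Phi_at a ^ k) = fps_to_fls (of_int_fps (C $ 0))"
    by (simp add: eq)
  then show ?thesis
    unfolding T_series_def of_int_fls_shift_fps by simp
qed

subsection \<open>Coefficients of the difference\<close>

lemma fls_bigO_I:
  assumes "\<And>i. i < n \<Longrightarrow> fls_nth f i = 0"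
  shows "fls_bigO n f"
  unfolding fls_bigO_def fls_X_intpow_times_conv_shift
  by (intro exI[of _ "fls_regpart (fls_shift n f)"] fls_eqI) (auto simp: assms)

lemma fls_bigO_shift: "fls_bigO n (fls_X_intpow n * fps_to_fls f)"
  unfolding fls_bigO_def by blast

context expansion
begin

text \<open>One Q^m comes from evaluating at X = Q, the other from the dilation Y = QX; hence
  q^(a-1) Q^m C_m = q^(2am) g_m.\<close>

lemma quotient_nth:
  assumes "denom a P * C = numer a P"
  shows "(Q ^ m * C $ m) $ n = (if n + a - 1 < 2 * a * m then 0 else g m $ (n + a - 1 - 2 * a * m))"
proof -
  have "q ^ (a - 1) * C $ m = Q ^ m * g m"
    using arg_cong[OF quotient_eq_dilate_G[OF assms], of "\<lambda>F. F $ m"] by simp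
  then have "q ^ (a - 1) * (Q ^ m * C $ m) = Q ^ m * (Q ^ m * g m)"
    by (subst mult.left_commute) (simp only:)
  also have "\<dots> = q ^ (2 * a * m) * g m"
    by (simp only: flip: mult.assoc power_add power_mult) (simp add: algebra_simps)
  finally have "(q ^ (a - 1) * (Q ^ m * C $ m)) $ (n + a - 1) = (q ^ (2 * a * m) * g m) $ (n + a - 1)"
    by simp
  moreover have "\<not> n + a - 1 < a - 1" "n + a - 1 - (a - 1) = n"
    using a by simp_all
  ultimately show ?thesis
    by (simp only: fps_X_power_mult_nth if_False)
qed

text \<open>The term m = 0 cancels against T, and multiples m >= 2d of d start only at j = 2ad. In
  this window the term m = d is alone.\<close>

lemma difference_nth:
  assumes C: "denom a P * C = numer a P" and d: "d \<ge> 1" and j: "j < 2 * int a * int d"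
  shows "fls_nth (fls_X_intpow (1 - int a) * fps_to_fls (average a d C)
      - fls_X_intpow (1 - int a) * fps_to_fls (C $ 0)) (E0 a d + j)
    = (if j < 0 then 0 else g d $ nat j)"
proof -
  define i where "i = int a * (2 * int d - 1) + 1 + j"
  have ad: "int a * (2 * int d - 1) \<ge> 2 * int d - 1"
    using a d by simp
  \<comment> \<open>Contrapositively, for j >= 0 the index d lies within the cut m <= n of
    \<open>average\<close>.\<close>
  have neg: "j < 0" if "i < int d"
    using that ad d unfolding i_def by linarith
  have i: "E0 a d + j + - (1 - int a) = i"
    by (simp add: E0_def i_def algebra_simps)
  have "fls_nth (fls_X_intpow (1 - int a) * fps_to_fls (average a d C)
      - fls_X_intpow (1 - int a) * fps_to_fls (C $ 0)) (E0 a d + j)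
    = fls_nth (fps_to_fls (average a d C - C $ 0)) i"
    unfolding fls_X_intpow_times_conv_shift fls_minus_nth fls_shift_nth fps_to_fls_minus
      i ..
  also have "\<dots> = (if j < 0 then 0 else g d $ nat j)"
  proof (cases "i < 0")
    case True
    then show ?thesis using neg d by simp
  next
    case False
    define n where "n = nat i"
    have n: "int (n + a - 1) = 2 * int a * int d + j"
      using False a by (simp add: n_def i_def algebra_simps)
    let ?c = "\<lambda>m. (Q ^ m * C $ m) $ n"
    have c: "?c m = (if n + a - 1 < 2 * a * m then 0 else g m $ (n + a - 1 - 2 * a * m))" for m
      by (rule quotient_nth[OF C])
    have zero: "?c m = 0" if m: "d dvd m" "m \<noteq> 0" "m \<noteq> d" for m
    proof -
      obtain l where l: "m = d * l" using m(1) by blast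
      have "l \<noteq> 0" "l \<noteq> 1"
        using m l by auto
      then have "2 \<le> l" by simp
      then have "2 * d \<le> m" by (simp add: l)
      then have "2 * a * (2 * d) \<le> 2 * a * m" by simp
      then have "int (2 * a * (2 * d)) \<le> int (2 * a * m)"
        by (simp only: of_nat_le_iff)
      moreover have "int (2 * a * (2 * d)) = 2 * (2 * int a * int d)"
        by simp
      ultimately have "int (n + a - 1) < int (2 * a * m)"
        unfolding n using j by linarith
      then show ?thesis by (simp only: c of_nat_less_iff if_True)
    qed
    have "(average a d C - C $ 0) $ n = (\<Sum>m | m \<le> n \<and> d dvd m. ?c m) - ?c 0"
      by (simp add: average_def)
    also have "\<dots> = (\<Sum>m\<in>{m. m \<le> n \<and> d dvd m} - {0}. ?c m)"
      by (subst sum.remove[of _ 0]) auto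
    also have "\<dots> = (if d \<le> n then ?c d else 0)"
    proof (cases "d \<le> n")
      case True
      then have "(\<Sum>m\<in>{m. m \<le> n \<and> d dvd m} - {0}. ?c m) = (\<Sum>m\<in>{d}. ?c m)"
        using d zero by (intro sum.mono_neutral_right) auto
      with True show ?thesis by simp
    next
      case False
      then have "{m. m \<le> n \<and> d dvd m} - {0} = {}"
        by (auto dest: dvd_imp_le)
      with False show ?thesis by (simp only: if_False sum.empty)
    qed
    also have "\<dots> = (if j < 0 then 0 else g d $ nat j)"
    proof (cases "j < 0")
      case True
      then have "int (n + a - 1) < int (2 * a * d)"
        unfolding n by simp
      then have "?c d = 0" by (simp only: c of_nat_less_iff if_True)
      with True show ?thesis by simp
    next
      case False
      then have "d \<le> n" using neg unfolding n_def by arith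
      moreover have "int (n + a - 1) = int (2 * a * d + nat j)"
        unfolding n using False by simp
      then have "n + a - 1 = 2 * a * d + nat j"
        by (simp only: of_nat_eq_iff)
      ultimately show ?thesis using False by (simp add: c)
    qed
    finally show ?thesis
      using False by (simp add: n_def)
  qed
  finally show ?thesis .
qed

text \<open>Places order \<open>v d\<close> in the range of \<open>difference_nth\<close>, for both
  values of t.\<close>

lemma v_less_2ad:
  assumes "d \<ge> 1" "t \<le> 2"
  shows "int (v d) < 2 * int a * int d"
proof -
  have ta: "t = 1 \<or> t = 2"
    using assms(2) t by auto
  have "(\<exists>p. d = 2 * p + 1) \<or> (\<exists>p. d = 2 * p + 2)"
    using assms(1) by presburger
  then have "v d < 2 * a * d"
  proof (elim disjE exE)
    fix p assume "d = 2 * p + 1"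
    then show ?thesis
      using v_odd[of d p] ta a by (auto simp: algebra_simps)
  next
    fix p assume "d = 2 * p + 2"
    then show ?thesis
      using v_even[of d p] ta a by (auto simp: algebra_simps)
  qed
  then have "int (v d) < int (2 * a * d)"
    by (simp only: of_nat_less_iff)
  then show ?thesis by simp
qed

text \<open>The bound is attained at r = \<open>v d\<close>, so the exponent of h falls to 0 exactly
  at the end of the range.\<close>

lemma floor_sum_le:
  assumes "t = 1" "r \<le> v d" "d \<ge> 1"
  shows "floor_sum r \<le> d - 1"
proof -
  have "(\<exists>p. d = 2 * p + 1) \<or> (\<exists>p. d = 2 * p + 2)"
    using assms(3) by presburger
  then show ?thesis
  proof (elim disjE exE)
    fix p assume d: "d = 2 * p + 1"
    then have "r \<le> a * p" using assms v_odd[of d p] by simp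
    then have "r < (p + 1) * a" "r + a - 1 < (p + 1) * a"
      using a by (simp_all add: algebra_simps)
    then have "r div a < p + 1" "(r + a - 1) div a < p + 1"
      by (simp_all only: less_mult_imp_div_less)
    then show ?thesis using d by (simp add: floor_sum_def)
  next
    fix p assume d: "d = 2 * p + 2"
    then have "r \<le> a * p + 1" using assms v_even[of d p] by simp
    then have "r < (p + 1) * a" "r + a - 1 < (p + 2) * a"
      using a by (simp_all add: algebra_simps)
    then have "r div a < p + 1" "(r + a - 1) div a < p + 2"
      by (simp_all only: less_mult_imp_div_less)
    then show ?thesis using d by (simp add: floor_sum_def)
  qed
qed

text \<open>The ceiling of r/a is 1 more than the floor of (r - 1)/a, also at r = 0 where that floor
  is -1; this turns d - 2 into d - 1.\<close>

lemma h_exponent_eq: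
  assumes "0 \<le> r"
  shows "h_exponent a d r = int d - 1 - int (floor_sum (nat r))"
proof -
  have "\<lfloor>real_of_int s / real a\<rfloor> = s div int a" for s
    using floor_divide_of_int_eq[of s "int a", where 'a = real] by simp
  note fl_div = this[of r] this[of "r - 1"]
  have "(r + int a - 1) div int a = (r - 1) div int a + 1"
    using a div_add_self2[of "int a" "r - 1"] by (simp add: algebra_simps)
  moreover have "int (floor_sum (nat r)) = r div int a + (r + int a - 1) div int a"
    using assms a by (simp add: floor_sum_def zdiv_int of_nat_diff)
  ultimately show ?thesis
    using fl_div by (simp add: h_exponent_def)
qed

lemma power_h_exponent_dvd:
  assumes "t = 1" "0 \<le> r" "r \<le> int (v d)" "d \<ge> 1"
  shows "0 \<le> h_exponent a d r" and "(k - 1) ^ nat (h_exponent a d r) dvd g d $ nat r"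
proof -
  have "floor_sum (nat r) \<le> d - 1"
    using assms by (intro floor_sum_le) auto
  then show "0 \<le> h_exponent a d r"
    using assms by (simp add: h_exponent_eq)
  have "nat (h_exponent a d r) = d - 1 - floor_sum (nat r)"
    using assms by (simp add: h_exponent_eq)
  then show "(k - 1) ^ nat (h_exponent a d r) dvd g d $ nat r"
    using g_in_M[of d] by (simp add: M_def)
qed

lemma E0_add_v:
  assumes "d \<ge> 1"
  shows "t = 1 \<Longrightarrow> E0 a d + int (v d) = Ed a d"
    and "t = 2 \<Longrightarrow> E0 a d + int (v d)
      = (if odd d then 3 * int a * (int d - 1) + 2 else int a * (3 * int d - 4) + 4)"
proof -
  have "(\<exists>p. d = 2 * p + 1) \<or> (\<exists>p. d = 2 * p + 2)"
    using assms by presburger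
  then show "t = 1 \<Longrightarrow> E0 a d + int (v d) = Ed a d"
    and "t = 2 \<Longrightarrow> E0 a d + int (v d)
      = (if odd d then 3 * int a * (int d - 1) + 2 else int a * (3 * int d - 4) + 4)"
    using v_odd[of d] v_even[of d]
    by (auto simp: E0_def Ed_def algebra_simps)
qed

end

section \<open>Low coefficients of powers of Phi\<close>

lemma mult_one_minus_X_power_nth:
  "(f * (1 - fps_X ^ k)) $ n = f $ n - (if n < k then 0 else f $ (n - k) :: 'a::comm_ring_1)"
  by (simp add: right_diff_distrib fps_X_power_mult_right_nth)

lemma Phi_int_nth: "Phi_int $ 0 = 1" "Phi_int $ 1 = -1" "Phi_int $ 2 = -1" "Phi_int $ 3 = 0"
  by (simp_all add: Phi_int_def eval_nat_numeral mult_one_minus_X_power_nth del: power_Suc)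

lemma Phi_int_power_nth:
  "(Phi_int ^ k) $ 0 = 1" "(Phi_int ^ k) $ 1 = - int k"
  "2 * (Phi_int ^ k) $ 2 = int k * (int k - 3)"
proof -
  show 0: "(Phi_int ^ k) $ 0 = 1" for k
    by (simp add: fps_power_zeroth Phi_int_nth)
  show 1: "(Phi_int ^ k) $ 1 = - int k" for k
    by (induction k) (use 0 in \<open>simp_all add: fps_mult_nth_1 Phi_int_nth[simplified]\<close>)
  show "2 * (Phi_int ^ k) $ 2 = int k * (int k - 3)"
  proof (induction k)
    case (Suc k)
    have "(Phi_int ^ Suc k) $ 2 = (Phi_int ^ k) $ 2 + int k - 1"
      using 0[of k] 1[of k] Phi_int_nth by (simp add: fps_mult_nth numeral_2_eq_2)
    with Suc show ?case by (simp add: algebra_simps)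
  qed simp
qed

text \<open>The 5 of Jacobi's series 1 - 3q + 5q^3 - 7q^6 + ...; its oddness gives part (v).\<close>

lemma Phi_int_cubed_nth: "(Phi_int ^ 3) $ 3 = 5"
  using Phi_int_nth[unfolded numeral_2_eq_2 numeral_3_eq_3 One_nat_def]
  by (simp add: power3_eq_cube fps_mult_nth numeral_3_eq_3)

lemma expansion_Phi_int:
  assumes "a \<ge> 2"
  shows "expansion a 1 (int k) (Phi_int ^ k) (fps_shift 2 (Phi_int ^ k))"
proof (unfold_locales; (intro fps_ext)?)
  fix n
  consider "n = 0" | "n = 1" | m where "n = Suc (Suc m)"
    by (metis One_nat_def not0_implies_Suc)
  then show "(Phi_int ^ k) $ n
      = (1 - fps_const (int k) * fps_X + fps_X ^ (1 + 1) * fps_shift 2 (Phi_int ^ k)) $ n"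
    using Phi_int_power_nth[of k]
    by cases (simp_all add: fps_X_power_mult_nth del: power_Suc)
qed (use assms in auto)

lemma expansion_Phi_int_cubed:
  assumes "a \<ge> 2"
  shows "expansion a 2 3 (Phi_int ^ 3) (fps_shift 3 (Phi_int ^ 3))"
proof (unfold_locales; (intro fps_ext)?)
  fix n :: nat
  have nth: "(Phi_int ^ 3) $ 0 = 1" "(Phi_int ^ 3) $ 1 = - 3" "(Phi_int ^ 3) $ 2 = 0"
    using Phi_int_power_nth[of 3] by simp_all
  have "n = 0 \<or> n = 1 \<or> n = 2 \<or> (\<exists>m. n = m + 3)"
    by presburger
  then consider "n = 0" | "n = 1" | "n = 2" | m where "n = m + 3"
    by blast
  then show "(Phi_int ^ 3) $ n
      = (1 - fps_const 3 * fps_X + fps_X ^ (2 + 1) * fps_shift 3 (Phi_int ^ 3)) $ n"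
    using nth by cases (simp_all add: fps_X_power_mult_nth del: power_Suc)
qed (use assms in auto)

lemma not_dvd_lead:
  fixes k s l :: int
  assumes "k - 1 \<ge> 3" and s: "2 * s = k * (k - 3)"
    and l: "l = k * (- s) ^ n \<or> l = s * (- s) ^ n"
  shows "\<not> k - 1 dvd l"
proof
  assume dvd: "k - 1 dvd l"
  \<comment> \<open>\<open>s\<close> need not be a unit modulo \<open>k - 1\<close>, but it is \<open>-1\<close> modulo \<open>h\<close>.\<close>
  define h where "h = (if odd (k - 1) then k - 1 else (k - 1) div 2)"
  \<comment> \<open>An even k - 1 >= 3 is at least 4, so its half is still at least 2.\<close>
  have h: "h dvd k - 1" "h \<ge> 2"
  proof -
    consider "odd (k - 1)" | b where "k - 1 = 2 * b"
      by blast
    then have "h dvd k - 1 \<and> h \<ge> 2"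
      using assms(1) by cases (auto simp: h_def)
    then show "h dvd k - 1" "h \<ge> 2" by simp_all
  qed
  \<comment> \<open>Cancelling the 2 costs a factor of k - 1 only when k - 1 is even, which is why h
    is halved in that case.\<close>
  have "2 * (s + 1) = (k - 1) * (k - 2)"
    using s by (simp add: algebra_simps)
  then have "h dvd s + 1"
  proof (cases "odd (k - 1)")
    case True
    then have "even (k - 2)" by simp
    then obtain b where "k - 2 = 2 * b" ..
    with \<open>2 * (s + 1) = (k - 1) * (k - 2)\<close> have "s + 1 = (k - 1) * b" by simp
    with True show ?thesis by (simp add: h_def)
  next
    case False
    then obtain b where b: "k - 1 = 2 * b" by blast
    with \<open>2 * (s + 1) = (k - 1) * (k - 2)\<close> have "s + 1 = b * (k - 2)" by simp
    with False b show ?thesis by (simp add: h_def)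
  qed
  then have s1: "[s = - 1] (mod h)" and k1: "[k = 1] (mod h)"
    using h(1) by (simp_all add: cong_iff_dvd_diff)
  then have "[- s = 1] (mod h)"
    using cong_minus_minus_iff[of s "- 1" h] by simp
  then have p: "[(- s) ^ n = 1 ^ n] (mod h)"
    by (rule cong_pow)
  from l have "[l = 1] (mod h) \<or> [l = - 1] (mod h)"
    using cong_mult[OF k1 p] cong_mult[OF s1 p] by auto
  moreover have "[l = 0] (mod h)"
    using dvd h(1) by (auto simp: cong_0_iff intro: dvd_trans)
  ultimately have "h dvd 1"
    by (metis cong_0_iff cong_sym cong_trans dvd_minus_iff)
  with h(2) show False by simp
qed

theorem theorem1p2:
  fixes a d k :: nat
  assumes "a \<ge> 2" and "d \<ge> 2" and "k \<ge> 1"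
  shows "\<exists>Wz Tz :: int fls.
    W_series a d k = of_int_fls Wz \<and> T_series a k = of_int_fls Tz \<and>
    fls_bigO (1 - int a) Wz \<and> fls_bigO (1 - int a) Tz \<and>
    (k \<ge> 2 \<longrightarrow>
      fls_bigO (E0 a d + 1)
        (Wz - Tz - fls_const (int k * (1 - int k) ^ (d - 1)) * fls_X_intpow (E0 a d))) \<and>
    (k = 1 \<longrightarrow>
      fls_bigO (Ed a d + 1)
        (Wz - Tz - fls_const ((-1) ^ (d - 1)) * fls_X_intpow (Ed a d))) \<and>
    (k \<ge> 3 \<longrightarrow>
      (\<forall>r. 0 \<le> r \<and> r \<le> Ed a d - E0 a d \<longrightarrow>
        0 \<le> h_exponent a d r \<and>
        (int k - 1) ^ nat (h_exponent a d r) dvd fls_nth (Wz - Tz) (E0 a d + r))) \<and>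
    (k \<ge> 3 \<and> int k - 1 \<ge> 3 \<longrightarrow>
      first_nonzero_mod (int k - 1) (Wz - Tz) (Ed a d) \<and>
      [fls_nth (Wz - Tz) (Ed a d) =
        (-1) ^ (d - 1) * (- (int k * (int k - 3) div 2)) ^ (d div 2)] (mod (int k - 1))) \<and>
    (k = 3 \<longrightarrow>
      (let N = (if odd d then 3 * int a * (int d - 1) + 2 else int a * (3 * int d - 4) + 4)
       in first_nonzero_mod 2 (Wz - Tz) N \<and> [fls_nth (Wz - Tz) N = 1] (mod 2)))"
proof -
  define P where "P = Phi_int ^ k"
  define s where "s = P $ 2"
  have s: "2 * s = int k * (int k - 3)"
    by (simp add: s_def P_def Phi_int_power_nth)
  interpret E: expansion a 1 "int k" P "fps_shift 2 P"
    unfolding P_def using assms(1) by (rule expansion_Phi_int)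
  have d: "d \<ge> 1" using assms by simp
  have "denom a P $ 0 $ 0 = 1"
    by (simp add: denom_def E.P_nth_0)
  then obtain B' where "denom a P * B' = 1"
    using fps_fps_right_invertible by blast
  then have "denom a P * (B' * numer a P) = numer a P"
    by (simp flip: mult.assoc)
  then obtain C where C: "denom a P * C = numer a P" ..
  define Wz where "Wz = fls_X_intpow (1 - int a) * fps_to_fls (average a d C)"
  define Tz where "Tz = fls_X_intpow (1 - int a) * fps_to_fls (C $ 0)"
  have W: "W_series a d k = of_int_fls Wz" and T: "T_series a k = of_int_fls Tz"
    unfolding Wz_def Tz_def using assms C
    by (simp_all only: P_def) (intro W_series_eq T_series_eq; simp)+
  have nth: "fls_nth (Wz - Tz) (E0 a d + j) = (if j < 0 then 0 else E.g d $ nat j)"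
    if "j < 2 * int a * int d" for j
    unfolding Wz_def Tz_def using C d that by (rule E.difference_nth)
  have v: "E0 a d + int (E.v d) = Ed a d" "int (E.v d) < 2 * int a * int d"
    using E.E0_add_v E.v_less_2ad d by simp_all
  have nth_Ed: "fls_nth (Wz - Tz) (Ed a d) = E.g d $ E.v d"
    using nth[of "int (E.v d)"] v by simp
  \<comment> \<open>The modulus stays free: k - 1 in (iv), and 0 for k = 1, where divisibility by 0
    means vanishing.\<close>
  have below: "h dvd fls_nth (Wz - Tz) i" if "h dvd int k - 1" "i < Ed a d" for h i
    using nth[of "i - E0 a d"] v E.g_coeff(1)[OF that(1) d, of "nat (i - E0 a d)"] that(2)
    by (auto simp: nat_less_iff)
  have at_Ed: "int k - 1 dvd fls_nth (Wz - Tz) (Ed a d) - E.lead d"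
    unfolding nth_Ed using d by (intro E.g_coeff(2)) auto
  have lead: "E.lead d = (if odd d then int k * (- s) ^ (d div 2) else s * (- s) ^ (d div 2 - 1))"
    by (simp add: E.lead_def s_def numeral_2_eq_2[symmetric])
  have lead_cong: "[E.lead d = (-1) ^ (d - 1) * (- s) ^ (d div 2)] (mod (int k - 1))"
  proof (cases "odd d")
    case True
    have "[int k * (- s) ^ (d div 2) = 1 * (- s) ^ (d div 2)] (mod (int k - 1))"
      by (intro cong_mult cong_refl) (simp add: cong_iff_dvd_diff)
    then show ?thesis using True by (simp add: lead)
  next
    case False
    then have "\<exists>e. d = 2 * e + 2"
      using assms(2) by presburger
    then obtain e where "d = 2 * e + 2" ..
    then have e: "d div 2 = e + 1" "d - 1 = 2 * e + 1"
      by simp_all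
    \<comment> \<open>Here s (-s)^e = -(-s)^(e+1), and d - 1 is odd.\<close>
    show ?thesis
      unfolding lead e using False by simp
  qed

  have i: "fls_bigO (E0 a d + 1)
        (Wz - Tz - fls_const (int k * (1 - int k) ^ (d - 1)) * fls_X_intpow (E0 a d))"
  proof (rule fls_bigO_I)
    fix j assume "j < E0 a d + 1"
    moreover have "0 < 2 * int a * int d"
      using assms by simp
    ultimately have "j \<le> E0 a d" "j - E0 a d < 2 * int a * int d"
      by linarith+
    then have "fls_nth (Wz - Tz) j = (if j = E0 a d then E.g d $ 0 else 0)"
      using nth[of "j - E0 a d"] by auto
    moreover have "E.g d $ 0 = int k * (1 - int k) ^ (d - 1)"
      using E.g_nth_0(2)[of "d - 1"] d by simp
    ultimately show "fls_nth (Wz - Tz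
        - fls_const (int k * (1 - int k) ^ (d - 1)) * fls_X_intpow (E0 a d)) j = 0"
      by (simp add: fls_mult_const_nth)
  qed

  have ii: "fls_bigO (Ed a d + 1)
        (Wz - Tz - fls_const ((-1) ^ (d - 1)) * fls_X_intpow (Ed a d))" if "k = 1"
  proof (rule fls_bigO_I)
    fix j assume "j < Ed a d + 1"
    moreover have "fls_nth (Wz - Tz) (Ed a d) = (-1) ^ (d - 1)"
    proof -
      \<comment> \<open>For k = 1 the identity 2 s = k (k - 3) reads 2 s = -2, and congruence modulo
        k - 1 = 0 is equality.\<close>
      have "s = - 1" using s that by simp
      then show ?thesis
        using at_Ed lead_cong that by (simp add: cong_iff_dvd_diff)
    qed
    moreover have "fls_nth (Wz - Tz) j = 0" if "j < Ed a d"
      using below[of 0 j] that \<open>k = 1\<close> by simp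
    ultimately show "fls_nth (Wz - Tz - fls_const ((-1) ^ (d - 1)) * fls_X_intpow (Ed a d)) j = 0"
      by (cases "j = Ed a d") (simp_all add: fls_mult_const_nth)
  qed

  have iii: "0 \<le> h_exponent a d r \<and>
        (int k - 1) ^ nat (h_exponent a d r) dvd fls_nth (Wz - Tz) (E0 a d + r)"
    if "0 \<le> r" "r \<le> Ed a d - E0 a d" for r
  proof -
    have r: "r \<le> int (E.v d)" using that v by simp
    then show ?thesis
      using E.power_h_exponent_dvd[OF refl that(1) r d] nth[of r] v that by simp
  qed

  have iv: "first_nonzero_mod (int k - 1) (Wz - Tz) (Ed a d) \<and>
      [fls_nth (Wz - Tz) (Ed a d) =
        (-1) ^ (d - 1) * (- (int k * (int k - 3) div 2)) ^ (d div 2)] (mod (int k - 1))"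
    if "int k - 1 \<ge> 3"
  proof
    have "\<not> int k - 1 dvd E.lead d"
      using that s by (rule not_dvd_lead[of _ _ _ "if odd d then d div 2 else d div 2 - 1"]) (simp add: lead)
    then have "\<not> int k - 1 dvd fls_nth (Wz - Tz) (Ed a d)"
      using at_Ed dvd_diff[of "int k - 1" "fls_nth (Wz - Tz) (Ed a d)"
          "fls_nth (Wz - Tz) (Ed a d) - E.lead d"] by auto
    then show "first_nonzero_mod (int k - 1) (Wz - Tz) (Ed a d)"
      unfolding first_nonzero_mod_def using below by simp
    have half: "int k * (int k - 3) div 2 = s"
      by (simp flip: s)
    have "[fls_nth (Wz - Tz) (Ed a d) = E.lead d] (mod (int k - 1))"
      using at_Ed by (simp only: cong_iff_dvd_diff)
    then show "[fls_nth (Wz - Tz) (Ed a d) =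
        (-1) ^ (d - 1) * (- (int k * (int k - 3) div 2)) ^ (d div 2)] (mod (int k - 1))"
      unfolding half using lead_cong by (rule cong_trans)
  qed

  have v: "let N = (if odd d then 3 * int a * (int d - 1) + 2 else int a * (3 * int d - 4) + 4)
       in first_nonzero_mod 2 (Wz - Tz) N \<and> [fls_nth (Wz - Tz) N = 1] (mod 2)" if k: "k = 3"
  proof -
    define N where "N = (if odd d then 3 * int a * (int d - 1) + 2 else int a * (3 * int d - 4) + 4)"
    \<comment> \<open>P and C stay the same. With t = 1 the leading coefficient would be 0, as Phi^3
      has no quadratic term; t = 2 reaches the cubic one.\<close>
    interpret E2: expansion a 2 3 P "fps_shift 3 P"
      unfolding P_def k using assms(1) by (rule expansion_Phi_int_cubed)
    have nth: "fls_nth (Wz - Tz) (E0 a d + j) = (if j < 0 then 0 else E2.g d $ nat j)"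
      if "j < 2 * int a * int d" for j
      unfolding Wz_def Tz_def using C d that by (rule E2.difference_nth)
    have v: "E0 a d + int (E2.v d) = N" "int (E2.v d) < 2 * int a * int d"
      using E2.E0_add_v E2.v_less_2ad d by (simp_all add: N_def)
    have "2 dvd fls_nth (Wz - Tz) i" if "i < N" for i
      using nth[of "i - E0 a d"] v E2.g_coeff(1)[of 2 d "nat (i - E0 a d)"] d that
      by (auto simp: nat_less_iff)
    moreover have "fls_nth (Wz - Tz) N = E2.g d $ E2.v d"
      using nth[of "int (E2.v d)"] v by simp
    then have "2 dvd fls_nth (Wz - Tz) N - E2.lead d"
      using E2.g_coeff(2)[of 2 d] d by simp
    \<comment> \<open>Up to sign \<open>lead\<close> is a product of powers of 3 and 5.\<close>
    moreover have "odd (E2.lead d)"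
      using Phi_int_cubed_nth unfolding E2.lead_def by (simp add: P_def k)
    ultimately show ?thesis
      unfolding Let_def N_def[symmetric] first_nonzero_mod_def
      by (auto simp: cong_iff_dvd_diff)
  qed

  have "fls_bigO (1 - int a) Wz" "fls_bigO (1 - int a) Tz"
    unfolding Wz_def Tz_def by (rule fls_bigO_shift)+
  with W T i ii iii iv v show ?thesis
    by - (rule exI[of _ Wz], rule exI[of _ Tz], blast)
qed

end
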